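(* Let $M$ be a differentiable manifold of dimension $d$, let $\rho$ be a distance metrizing the topology of $M$, and let $Q$ be a probability measure on the Borel sigma-field of $M$. Let $X_1,X_2,\ldots,X_n$ be i.i.d. with common distribution $Q$. Suppose that the following assumptions hold: (i) $Q$ has support in a single coordinate patch $(U,\phi)$, $\phi:U\to\mathbb{R}^d$ smooth. Let $Y_j=\phi(X_j)$, $j=1,\ldots,n$. (ii) The Fréchet mean $\mu_F$ of $Q$ is unique. (iii) For all $x$, the map $y\mapsto h(x,y)=\rho^2(\phi^{-1}x,\phi^{-1}y)$ is twice continuously differentiable in a neighborhood of $\phi(\mu_F)=\mu$. (iv) $E\big(D_rh(Y_1,\mu)\big)^2<\infty$ for all $r$. (v) $E\Big(\sup_{|u-v|\le\epsilon}\big|D_sD_rh(Y_1,v)-D_sD_rh(Y_1,u)\big|\Big)\to0$ as $\epsilon\to0$, for all $r,s$. (vi) $\Lambda=E\big(D_sD_rh(Y_1,\mu)\big)$ (the $d\times d$ matrix with entries indexed by $r,s$) is nonsingular. (vii) $\Sigma=\mathrm{Cov}(Dh(Y_1,\mu))$ is nonsingular. Assume in addition that $E(\rho^4(X_1,\mu_F))<\infty$. Let $V$ be the Fréchet variation of $Q$ and $V_n$ the sample Fréchet variation based on $X_1,\ldots,X_n$. Then, as $n\to\infty$, $$\sqrt n\,(V_n-V)\xrightarrow{\mathcal L}N\big(0,\mathrm{var}(\rho^2(X_1,\mu_F))\big).$$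
   Context: For a probability measure $Q$ on a metric space $(M,\rho)$, the Fréchet function is $F(p)=\int_M\rho^2(p,x)\,Q(dx)$, $p\in M$. If $F(p)<\infty$ for some $p\in M$, the set of all $p$ at which $F$ attains its minimum value on $M$ is the Fréchet mean set of $Q$; if it is a singleton $\{\mu_F\}$, then $\mu_F$ is called the Fréchet mean of $Q$ (and the Fréchet mean is said to be unique). The Fréchet variation $V$ of $Q$ is the minimum value attained by $F$ on $M$. The sample Fréchet function is $F_n(p)=\frac1n\sum_{j=1}^n\rho^2(X_j,p)$, and the sample Fréchet variation $V_n$ is the minimum value attained by $F_n$ on $M$. $D_rh(x,y)$ denotes the partial derivative of $y\mapsto h(x,y)$ with respect to the $r$-th coordinate of $y$ ($1\le r\le d$), and $Dh=(D_1h,\ldots,D_dh)'$. $\xrightarrow{\mathcal L}$ denotes convergence in distribution; $N(0,\sigma^2)$ is the normal law with mean $0$ and variance $\sigma^2$.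
   Formalization: The Fréchet mean is also assumed well separated: for every ε>0, inf of F(p) over ρ(p,μ_F)≥ε exceeds F(μ_F) (automatic if closed bounded sets are compact); without this the claim can fail. In (iii) and (v) one neighborhood of μ serves all x. *)

theory Defs
  imports "HOL-Probability.Probability"
begin

subsection \<open>Differentiable manifolds\<close>

text \<open>
  \<open>Ck_on k f S\<close>: \<open>f\<close> is \<open>k\<close> times continuously differentiable on the open set \<open>S\<close>; the
  derivative map is required to be \<open>C\<^sup>k\<close> direction by direction, which is equivalent in finite
  dimension.
\<close>

fun Ck_on :: "nat \<Rightarrow> ('a::euclidean_space \<Rightarrow> 'b::real_normed_vector) \<Rightarrow> 'a set \<Rightarrow> bool" where
  "Ck_on 0 f S \<longleftrightarrow> continuous_on S f"
| "Ck_on (Suc k) f S \<longleftrightarrow>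
     (\<forall>x\<in>S. f differentiable (at x)) \<and>
     (\<forall>v. Ck_on k (\<lambda>x. frechet_derivative f (at x) v) S)"

definition smooth_on :: "('a::euclidean_space \<Rightarrow> 'b::real_normed_vector) \<Rightarrow> 'a set \<Rightarrow> bool" where
  "smooth_on f S \<longleftrightarrow> (\<forall>k. Ck_on k f S)"

text \<open>
  A chart is a pair of a domain and a map that is total as a HOL function; only its values on
  the domain matter.
\<close>

definition topological_chart ::
    "'m::topological_space set \<Rightarrow> ('m \<Rightarrow> real^'d) \<Rightarrow> bool" where
  "topological_chart U \<phi> \<longleftrightarrow>
     open U \<and> open (\<phi> ` U) \<and> inj_on \<phi> U \<and> homeomorphism U (\<phi> ` U) \<phi> (inv_into U \<phi>)"

definition smoothly_compatible ::
    "'m set \<Rightarrow> ('m \<Rightarrow> real^'d) \<Rightarrow> 'm set \<Rightarrow> ('m \<Rightarrow> real^'d) \<Rightarrow> bool" where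
  "smoothly_compatible U \<phi> W \<psi> \<longleftrightarrow>
     smooth_on (\<psi> \<circ> inv_into U \<phi>) (\<phi> ` (U \<inter> W)) \<and>
     smooth_on (\<phi> \<circ> inv_into W \<psi>) (\<psi> ` (U \<inter> W))"

text \<open>
  A differentiable manifold of dimension \<open>CARD('d)\<close> is a second countable Hausdorff type \<open>'m\<close>
  together with a smooth atlas.
\<close>

definition smooth_atlas ::
    "('m::{t2_space, second_countable_topology} set \<times> ('m \<Rightarrow> real^'d)) set \<Rightarrow> bool" where
  "smooth_atlas A \<longleftrightarrow>
     (\<forall>(U, \<phi>)\<in>A. topological_chart U \<phi>) \<and>
     (\<Union>(U, \<phi>)\<in>A. U) = UNIV \<and>
     (\<forall>(U, \<phi>)\<in>A. \<forall>(W, \<psi>)\<in>A. smoothly_compatible U \<phi> W \<psi>)"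

text \<open>Coordinate patches are the charts of the maximal atlas generated by \<open>A\<close>.\<close>

definition coordinate_patch ::
    "('m::{t2_space, second_countable_topology} set \<times> ('m \<Rightarrow> real^'d)) set
      \<Rightarrow> 'm set \<Rightarrow> ('m \<Rightarrow> real^'d) \<Rightarrow> bool" where
  "coordinate_patch A U \<phi> \<longleftrightarrow>
     topological_chart U \<phi> \<and> (\<forall>(W, \<psi>)\<in>A. smoothly_compatible U \<phi> W \<psi>)"


subsection \<open>Frechet means and variations\<close>

text \<open>
  Values are in \<^typ>\<open>ennreal\<close>, so that an infinite integral is not silently replaced by \<open>0\<close>.
\<close>

definition frechet_fun :: "'m::metric_space measure \<Rightarrow> 'm \<Rightarrow> ennreal" where
  "frechet_fun Q p = (\<integral>\<^sup>+ x. ennreal ((dist p x)\<^sup>2) \<partial>Q)"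

definition frechet_mean_set :: "'m::metric_space measure \<Rightarrow> 'm set" where
  "frechet_mean_set Q =
     {p. frechet_fun Q p < \<infinity> \<and> (\<forall>q. frechet_fun Q p \<le> frechet_fun Q q)}"

text \<open>
  The variations are defined as infima; they are the minimum values whenever these are attained.
\<close>

definition frechet_variation :: "'m::metric_space measure \<Rightarrow> real" where
  "frechet_variation Q = enn2real (INF p. frechet_fun Q p)"

text \<open>The sample \<open>X\<^sub>1, \<dots>, X\<^sub>n\<close> is indexed as \<open>X 0, \<dots>, X (n - 1)\<close>.\<close>

definition sample_frechet_fun :: "(nat \<Rightarrow> 'm::metric_space) \<Rightarrow> nat \<Rightarrow> 'm \<Rightarrow> real" where
  "sample_frechet_fun X n p = (\<Sum>j<n. (dist (X j) p)\<^sup>2) / real n"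

definition sample_frechet_variation :: "(nat \<Rightarrow> 'm::metric_space) \<Rightarrow> nat \<Rightarrow> real" where
  "sample_frechet_variation X n = (INF p. sample_frechet_fun X n p)"

text \<open>
  Uniqueness of the minimizer \<open>\<mu>\<close> alone does not prevent the Frechet function from
  approaching its minimum value far away from \<open>\<mu>\<close> when \<open>'m\<close> has non-compact closed balls, and
  then the sample Frechet means need not be consistent.  The following condition excludes this;
  by the lemma below it is automatic when closed bounded sets are compact.
\<close>

definition well_separated_mean :: "'m::metric_space measure \<Rightarrow> 'm \<Rightarrow> bool" where
  "well_separated_mean Q \<mu> \<longleftrightarrow>
     (\<forall>\<epsilon>>0. \<exists>\<delta>>0. \<forall>p. dist p \<mu> \<ge> \<epsilon> \<longrightarrow> frechet_fun Q p \<ge> frechet_fun Q \<mu> + ennreal \<delta>)"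

lemma well_separated_mean_if_closed_bounded_compact:
  fixes Q :: "'m::metric_space measure"
  assumes HB: "\<And>S :: 'm set. closed S \<Longrightarrow> bounded S \<Longrightarrow> compact S"
    and Q: "prob_space Q" "sets Q = sets borel"
    and mean: "frechet_mean_set Q = {\<mu>}"
  shows "well_separated_mean Q \<mu>"
proof (rule ccontr)
  interpret prob_space Q by fact
  have [measurable]: "(\<lambda>x. dist p x) \<in> borel_measurable Q" for p :: 'm
    unfolding measurable_cong_sets[OF Q(2) refl]
    by (intro borel_measurable_continuous_onI continuous_intros)
  have fin: "frechet_fun Q \<mu> < \<infinity>" and mn: "\<And>q. frechet_fun Q \<mu> \<le> frechet_fun Q q"
    using mean by (auto simp: frechet_mean_set_def)
  assume "\<not> well_separated_mean Q \<mu>"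
  then obtain \<epsilon> where \<epsilon>: "\<epsilon> > 0"
    and *: "\<forall>\<delta>>0. \<exists>p. dist p \<mu> \<ge> \<epsilon> \<and> frechet_fun Q p < frechet_fun Q \<mu> + ennreal \<delta>"
    unfolding well_separated_mean_def by (auto simp: not_le)
  have "\<forall>k. \<exists>p. dist p \<mu> \<ge> \<epsilon> \<and> frechet_fun Q p < frechet_fun Q \<mu> + ennreal (inverse (real (Suc k)))"
    using * by simp
  then obtain p where p: "\<And>k. dist (p k) \<mu> \<ge> \<epsilon>"
    and pF: "\<And>k. frechet_fun Q (p k) < frechet_fun Q \<mu> + ennreal (inverse (real (Suc k)))"
    by metis
  define B where "B = 2 * (frechet_fun Q \<mu> + 1) + 2 * frechet_fun Q \<mu>"
  have B: "B < \<infinity>" using fin by (simp add: B_def ennreal_mult_less_top)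
  have bd: "ennreal ((dist (p k) \<mu>)\<^sup>2) \<le> B" for k
  proof -
    have "(dist (p k) \<mu>)\<^sup>2 \<le> 2 * (dist (p k) x)\<^sup>2 + 2 * (dist \<mu> x)\<^sup>2" for x
    proof -
      have "(dist (p k) \<mu>)\<^sup>2 \<le> (dist (p k) x + dist \<mu> x)\<^sup>2"
        by (intro power_mono dist_triangle2) auto
      also have "\<dots> \<le> 2 * (dist (p k) x)\<^sup>2 + 2 * (dist \<mu> x)\<^sup>2"
        using sum_squares_bound[of "dist (p k) x" "dist \<mu> x"] by (simp add: power2_sum)
      finally show ?thesis .
    qed
    then have "(\<integral>\<^sup>+ x. ennreal ((dist (p k) \<mu>)\<^sup>2) \<partial>Q)
        \<le> (\<integral>\<^sup>+ x. 2 * ennreal ((dist (p k) x)\<^sup>2) + 2 * ennreal ((dist \<mu> x)\<^sup>2) \<partial>Q)"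
      by (intro nn_integral_mono)
        (simp add: ennreal_leI flip: ennreal_plus ennreal_mult' ennreal_numeral)
    also have "\<dots> = 2 * frechet_fun Q (p k) + 2 * frechet_fun Q \<mu>"
      by (simp add: nn_integral_add nn_integral_cmult frechet_fun_def)
    also have "frechet_fun Q (p k) \<le> frechet_fun Q \<mu> + 1"
    proof -
      have "ennreal (inverse (real (Suc k))) \<le> 1"
        by (simp add: inverse_le_1_iff)
      then show ?thesis using pF[of k] by (meson add_left_mono less_imp_le order_trans)
    qed
    finally show ?thesis
      by (simp add: emeasure_space_1 B_def mult_left_mono add_mono)
  qed
  have "bounded (range p)"
  proof -
    have "dist \<mu> (p k) \<le> sqrt (enn2real B)" for k
    proof -
      have "(dist (p k) \<mu>)\<^sup>2 \<le> enn2real B"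
        using bd[of k] B by (metis enn2real_ennreal enn2real_mono infinity_ennreal_def
            zero_le_power2)
      then show ?thesis by (simp add: real_le_rsqrt dist_commute)
    qed
    then show ?thesis unfolding bounded_def by blast
  qed
  then have "compact (closure (range p))"
    by (intro HB) (auto simp: bounded_closure)
  then obtain l r where r: "strict_mono (r::nat\<Rightarrow>nat)" and l: "(p \<circ> r) \<longlonglongrightarrow> l"
    unfolding compact_eq_seq_compact_metric seq_compact_def
    by (metis closure_subset range_subsetD)
  have "frechet_fun Q l = (\<integral>\<^sup>+ x. liminf (\<lambda>k. ennreal ((dist (p (r k)) x)\<^sup>2)) \<partial>Q)"
  proof -
    have "(\<lambda>k. ennreal ((dist (p (r k)) x)\<^sup>2)) \<longlonglongrightarrow> ennreal ((dist l x)\<^sup>2)" for x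
      using l by (intro tendsto_intros) (auto simp: o_def)
    then have "liminf (\<lambda>k. ennreal ((dist (p (r k)) x)\<^sup>2)) = ennreal ((dist l x)\<^sup>2)" for x
      by (intro lim_imp_Liminf) auto
    then show ?thesis by (simp add: frechet_fun_def)
  qed
  also have "\<dots> \<le> liminf (\<lambda>k. frechet_fun Q (p (r k)))"
    unfolding frechet_fun_def by (intro nn_integral_liminf) measurable
  also have "\<dots> \<le> liminf (\<lambda>k. frechet_fun Q \<mu> + ennreal (inverse (real (Suc (r k)))))"
    by (intro Liminf_mono always_eventually allI less_imp_le pF)
  also have "\<dots> = frechet_fun Q \<mu> + ennreal 0"
  proof (intro lim_imp_Liminf tendsto_add tendsto_const tendsto_ennrealI)
    show "(\<lambda>k. inverse (real (Suc (r k)))) \<longlonglongrightarrow> 0"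
      using LIMSEQ_subseq_LIMSEQ[OF LIMSEQ_inverse_real_of_nat r] by (simp add: o_def)
  qed auto
  finally have "frechet_fun Q l \<le> frechet_fun Q \<mu>" by simp
  then have "l \<in> frechet_mean_set Q"
    using fin mn by (auto simp: frechet_mean_set_def intro: order_trans le_less_trans)
  then have "l = \<mu>" using mean by simp
  moreover have "dist l \<mu> \<ge> \<epsilon>"
    using l p by (intro Lim_bounded2[OF tendsto_dist[OF l tendsto_const]]) auto
  ultimately show False using \<epsilon> by simp
qed


subsection \<open>The squared distance in coordinates\<close>

definition chart_sqdist ::
    "'m::metric_space set \<Rightarrow> ('m \<Rightarrow> real^'d) \<Rightarrow> real^'d \<Rightarrow> real^'d \<Rightarrow> real" where
  "chart_sqdist U \<phi> x y = (dist (inv_into U \<phi> x) (inv_into U \<phi> y))\<^sup>2"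

definition partial_deriv :: "'d::finite \<Rightarrow> (real^'d \<Rightarrow> real) \<Rightarrow> real^'d \<Rightarrow> real" where
  "partial_deriv r f y = deriv (\<lambda>t. f (y + t *\<^sub>R axis r 1)) 0"

definition gradient :: "(real^'d \<Rightarrow> real) \<Rightarrow> real^'d \<Rightarrow> real^'d" where
  "gradient f y = (\<chi> r. partial_deriv r f y)"

text \<open>
  The law of \<open>Y\<^sub>1 = \<phi>(X\<^sub>1)\<close>.  Since \<open>X\<^sub>1\<close> lies in \<open>U\<close> only almost surely and \<open>\<phi>\<close> is an
  arbitrary function off \<open>U\<close>, it is the image under \<open>\<phi>\<close> of \<open>Q\<close> restricted to \<open>U\<close>;
  \<open>E(g(Y\<^sub>1))\<close> is the integral of \<open>g\<close> against it.
\<close>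

definition coord_law :: "'m::topological_space measure \<Rightarrow> 'm set \<Rightarrow> ('m \<Rightarrow> real^'d) \<Rightarrow> (real^'d) measure"
  where "coord_law Q U \<phi> = distr (restrict_space Q U) borel \<phi>"

definition cov_matrix :: "'a measure \<Rightarrow> ('a \<Rightarrow> real^'d) \<Rightarrow> real^'d^'d" where
  "cov_matrix M g = (\<chi> r s. \<integral> x. (g x $ r - (\<integral> z. g z $ r \<partial>M)) * (g x $ s - (\<integral> z. g z $ s \<partial>M)) \<partial>M)"

text \<open>\<open>N(m, v)\<close> as an affine image of \<open>N(0, 1)\<close>, so that \<open>N(m, 0)\<close> is the point mass at \<open>m\<close>.\<close>

definition normal_law :: "real \<Rightarrow> real \<Rightarrow> real measure" where
  "normal_law m v = distr std_normal_distribution borel (\<lambda>z. m + sqrt v * z)"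

end

theory Submission
  imports Defs
begin

text \<open>
  Write \<open>F\<close> and \<open>F\<^sub>n\<close> for the Frechet function and the sample Frechet function.  Up to a remainder,
  \<open>sqrt n * (V\<^sub>n - V)\<close> is \<open>sqrt n * (F\<^sub>n \<mu>\<^sub>F - F \<mu>\<^sub>F)\<close>, a normalized sum of the i.i.d. square integrable
  variables \<open>\<rho>\<^sup>2(X\<^sub>j, \<mu>\<^sub>F)\<close>, for which the central limit theorem holds (\<open>central_limit_sample_mean\<close>,
  which includes a vanishing variance).  By \<open>Slutsky\<close> it is enough that the nonnegative remainder
  \<open>sqrt n * (F\<^sub>n \<mu>\<^sub>F - inf F\<^sub>n)\<close> tends to zero in probability, that is, to bound
  \<open>F\<^sub>n p\<close> from below for all \<open>p\<close> simultaneously.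

  Near \<open>\<mu>\<^sub>F\<close>, in coordinates \<open>\<mu> + w\<close>, the sample Frechet function has the expansion
  \<open>F\<^sub>n (\<mu> + w) - F\<^sub>n \<mu> = g\<^sub>n \<bullet> w + w \<bullet> (\<Lambda>\<^sub>n w) / 2\<close> with an error of at most \<open>m\<^sub>n |w|\<^sup>2\<close>.  Here \<open>m\<^sub>n\<close> is a
  sample mean with small expectation, by the hypothesis on the oscillation of the second
  derivatives (\<open>Taylor_expansion_in_mean\<close>).  The same expansion of \<open>F\<close> at its minimum shows that
  \<open>g\<^sub>n\<close> has mean zero and that \<open>\<Lambda>\<close> is positive semidefinite; being symmetric and invertible, \<open>\<Lambda>\<close> is
  positive definite.  As \<open>\<Lambda>\<^sub>n\<close> tends to \<open>\<Lambda>\<close> by the law of large numbers,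
  \<open>F\<^sub>n (\<mu> + w) - F\<^sub>n \<mu> \<ge> g\<^sub>n \<bullet> w + c |w|\<^sup>2 \<ge> - |g\<^sub>n|\<^sup>2 / (4 c)\<close> with probability tending to one, and
  \<open>sqrt n * |g\<^sub>n|\<^sup>2\<close> has expectation of order \<open>1 / sqrt n\<close> (\<open>sample_minimum_excess_whp\<close>).

  Far from \<open>\<mu>\<^sub>F\<close> the Frechet function exceeds its minimum by a fixed amount, and \<open>F\<^sub>n\<close> inherits this
  uniformly although the region need not be bounded or relatively compact.  The reason is that
  \<open>sqrt (F p)\<close> and \<open>sqrt (F\<^sub>n p)\<close> are the Wasserstein distances of order two from the point mass at
  \<open>p\<close> to the law and to the empirical law, so they differ by at most the distance between these
  two laws, whatever \<open>p\<close> is.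
  \<open>sample_frechet_lower_bound_whp\<close> makes this elementary by rounding the sample points to finitely
  many values.
\<close>

section \<open>Events whose probability tends to one\<close>

text \<open>
  Convergence in probability is used in the form "an event has probability tending to one".
  The inner events \<open>B n\<close> allow predicates that quantify over uncountably many parameters, whose
  measurability would otherwise have to be established.
\<close>

definition (in prob_space) whp :: "(nat \<Rightarrow> 'a \<Rightarrow> bool) \<Rightarrow> bool" where
  "whp A \<longleftrightarrow> (\<exists>B. (\<forall>n. B n \<in> events \<and> (\<forall>\<omega>\<in>B n. A n \<omega>)) \<and> (\<lambda>n. prob (B n)) \<longlonglongrightarrow> 1)"

context prob_space
begin

lemma whpI:
  assumes "\<And>n. B n \<in> events" "\<And>n \<omega>. \<omega> \<in> B n \<Longrightarrow> A n \<omega>" "(\<lambda>n. prob (B n)) \<longlonglongrightarrow> 1"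
  shows "whp A"
  using assms unfolding whp_def by blast

lemma whp_mono:
  assumes "whp A" and "\<And>n \<omega>. \<omega> \<in> space M \<Longrightarrow> A n \<omega> \<Longrightarrow> C n \<omega>"
  shows "whp C"
proof -
  obtain B where B: "\<And>n. B n \<in> events" "\<And>n \<omega>. \<omega> \<in> B n \<Longrightarrow> A n \<omega>" "(\<lambda>n. prob (B n)) \<longlonglongrightarrow> 1"
    using assms(1) unfolding whp_def by blast
  show ?thesis
    by (rule whpI[of B]) (use B assms(2) sets.sets_into_space[OF B(1)] in blast)+
qed

lemma prob_tendsto_1:
  assumes "\<And>n. f n \<le> prob (B n)" "f \<longlonglongrightarrow> 1"
  shows "(\<lambda>n. prob (B n)) \<longlonglongrightarrow> 1"
  by (rule tendsto_sandwich[where f=f and h="\<lambda>_. 1"]) (simp_all add: assms)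

lemma whp_conj:
  assumes "whp A" "whp C"
  shows "whp (\<lambda>n \<omega>. A n \<omega> \<and> C n \<omega>)"
proof -
  obtain B where B: "\<And>n. B n \<in> events" "\<And>n \<omega>. \<omega> \<in> B n \<Longrightarrow> A n \<omega>" "(\<lambda>n. prob (B n)) \<longlonglongrightarrow> 1"
    using assms(1) unfolding whp_def by blast
  obtain D where D: "\<And>n. D n \<in> events" "\<And>n \<omega>. \<omega> \<in> D n \<Longrightarrow> C n \<omega>" "(\<lambda>n. prob (D n)) \<longlonglongrightarrow> 1"
    using assms(2) unfolding whp_def by blast
  have le: "prob (B n) + prob (D n) - 1 \<le> prob (B n \<inter> D n)" for n
  proof -
    have "prob (B n \<union> D n) = prob (B n) + prob (D n) - prob (B n \<inter> D n)"
      using finite_measure_Union'[OF B(1)[of n] D(1)[of n]] finite_measure_Diff'[OF D(1)[of n] B(1)[of n]]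
      by (simp add: Int_commute)
    then show ?thesis using prob_le_1[of "B n \<union> D n"] by linarith
  qed
  have "(\<lambda>n. prob (B n) + prob (D n) - 1) \<longlonglongrightarrow> 1 + 1 - 1"
    by (intro tendsto_intros B D)
  then have "(\<lambda>n. prob (B n \<inter> D n)) \<longlonglongrightarrow> 1"
    using prob_tendsto_1[OF le] by simp
  then show ?thesis
    by (intro whpI[of "\<lambda>n. B n \<inter> D n"]) (use B D in auto)
qed

lemma whp_eventually:
  assumes "\<forall>\<^sub>F n in sequentially. \<forall>\<omega>\<in>space M. A n \<omega>"
  shows "whp A"
proof (rule whpI[of "\<lambda>n. if \<forall>\<omega>\<in>space M. A n \<omega> then space M else {}"])
  show "(\<lambda>n. prob (if \<forall>\<omega>\<in>space M. A n \<omega> then space M else {})) \<longlonglongrightarrow> 1"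
    by (rule tendsto_eventually, rule eventually_mono[OF assms]) (simp add: prob_space)
qed (auto split: if_splits)

lemma whp_AE:
  assumes "\<And>n. AE \<omega> in M. A n \<omega>"
  shows "whp A"
proof -
  have "\<exists>B. B \<in> events \<and> (\<forall>\<omega>\<in>B. A n \<omega>) \<and> prob B = 1" for n
  proof -
    from assms[of n] obtain N where N: "{\<omega>\<in>space M. \<not> A n \<omega>} \<subseteq> N" "emeasure M N = 0" "N \<in> events"
      by (rule AE_E)
    then have "prob N = 0" by (simp add: measure_def)
    then have "prob (space M - N) = 1" using prob_compl[OF N(3)] by simp
    then show ?thesis using N by (intro exI[of _ "space M - N"]) auto
  qed
  then obtain B where "\<And>n. B n \<in> events" "\<And>n \<omega>. \<omega>\<in>B n \<Longrightarrow> A n \<omega>" "\<And>n. prob (B n) = 1"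
    by metis
  then show ?thesis by (intro whpI[of B]) auto
qed

lemma whp_ball_finite:
  assumes "finite I" "\<And>i. i \<in> I \<Longrightarrow> whp (A i)"
  shows "whp (\<lambda>n \<omega>. \<forall>i\<in>I. A i n \<omega>)"
  using assms
proof (induction I)
  case empty
  show ?case by (rule whp_eventually) simp
next
  case (insert i I)
  then have "whp (\<lambda>n \<omega>. A i n \<omega> \<and> (\<forall>i\<in>I. A i n \<omega>))"
    by (intro whp_conj) auto
  then show ?case by (rule whp_mono) auto
qed

lemma whp_Markov:
  fixes Z :: "nat \<Rightarrow> 'a \<Rightarrow> real"
  assumes int: "\<And>n. integrable M (Z n)" and nn: "\<And>n \<omega>. 0 \<le> Z n \<omega>"
    and lim: "(\<lambda>n. expectation (Z n)) \<longlonglongrightarrow> 0" and e: "e > 0"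
  shows "whp (\<lambda>n \<omega>. Z n \<omega> < e)"
proof (rule whpI[of "\<lambda>n. {\<omega>\<in>space M. Z n \<omega> < e}"])
  have [measurable]: "Z n \<in> borel_measurable M" for n using int by auto
  show "{\<omega>\<in>space M. Z n \<omega> < e} \<in> events" for n by measurable
  have "1 - expectation (Z n) / e \<le> prob {\<omega>\<in>space M. Z n \<omega> < e}" for n
  proof -
    have "prob {\<omega>\<in>space M. Z n \<omega> \<ge> e} \<le> expectation (Z n) / e"
      by (rule integral_Markov_inequality_measure[where A="space M - {}"])
         (use int nn e in \<open>auto\<close>)
    moreover have "{\<omega>\<in>space M. Z n \<omega> < e} = space M - {\<omega>\<in>space M. Z n \<omega> \<ge> e}" by auto
    ultimately show ?thesis by (simp add: prob_compl)
  qed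
  moreover have "(\<lambda>n. 1 - expectation (Z n) / e) \<longlonglongrightarrow> 1 - 0 / e"
    by (intro tendsto_intros lim) (use e in auto)
  ultimately show "(\<lambda>n. prob {\<omega>\<in>space M. Z n \<omega> < e}) \<longlonglongrightarrow> 1"
    using prob_tendsto_1[of "\<lambda>n. 1 - expectation (Z n) / e" "\<lambda>n. {\<omega>\<in>space M. Z n \<omega> < e}"]
    by simp
qed auto

end

section \<open>Sample means of independent identically distributed variables\<close>

definition sample_mean :: "(nat \<Rightarrow> 'x) \<Rightarrow> ('x \<Rightarrow> real) \<Rightarrow> nat \<Rightarrow> real" where
  "sample_mean x f n = (\<Sum>j<n. f (x j)) / real n"

lemma sample_mean_mono: "(\<And>j. f (x j) \<le> g (x j)) \<Longrightarrow> sample_mean x f n \<le> sample_mean x g n"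
  by (simp add: sample_mean_def divide_right_mono sum_mono)

lemma sample_mean_add: "sample_mean x (\<lambda>y. f y + g y) n = sample_mean x f n + sample_mean x g n"
  by (simp add: sample_mean_def sum.distrib add_divide_distrib)

lemma sample_mean_cmult: "sample_mean x (\<lambda>y. c * f y) n = c * sample_mean x f n"
  by (simp add: sample_mean_def sum_distrib_left)

lemma sample_mean_sum:
  "sample_mean x (\<lambda>y. \<Sum>i\<in>I. f i y) n = (\<Sum>i\<in>I. sample_mean x (f i) n)"
  by (simp add: sample_mean_def sum.swap[of _ I] sum_divide_distrib)

lemma sample_mean_nonneg: "(\<And>x. 0 \<le> f x) \<Longrightarrow> 0 \<le> sample_mean x f n"
  by (simp add: sample_mean_def sum_nonneg)

lemma sample_mean_diff:
  "sample_mean x (\<lambda>y. f y - g y) n = sample_mean x f n - sample_mean x g n"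
  by (simp add: sample_mean_def sum_subtractf diff_divide_distrib)

locale iid_sample = prob_space P for P :: "'w measure" +
  fixes X :: "nat \<Rightarrow> 'w \<Rightarrow> 'x::topological_space" and Q :: "'x measure"
  assumes indep: "indep_vars (\<lambda>_. borel) X UNIV"
    and law: "\<And>j. distr P borel (X j) = Q"
begin

lemma X_measurable [measurable]: "X j \<in> measurable P borel"
  using indep by (auto simp: indep_vars_def)

lemma sets_Q [measurable_cong]: "sets Q = sets borel"
  using law[of 0] by (metis sets_distr)

lemma space_Q [simp]: "space Q = UNIV"
  using sets_Q by (metis sets_eq_imp_space_eq space_borel)

lemma prob_space_Q: "prob_space Q"
  using law[of 0] by (metis X_measurable prob_space_distr)

lemma borel_measurable_if_integrable: "integrable Q f \<Longrightarrow> f \<in> borel_measurable borel"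
  for f :: "'x \<Rightarrow> real"
  using borel_measurable_integrable measurable_cong_sets[OF sets_Q refl] by blast

lemma integrable_X: "integrable Q f \<Longrightarrow> integrable P (\<lambda>\<omega>. f (X j \<omega>))"
  for f :: "'x \<Rightarrow> real"
  using law[of j] by (metis X_measurable integrable_distr)

lemma integral_X: "f \<in> borel_measurable borel \<Longrightarrow> expectation (\<lambda>\<omega>. f (X j \<omega>)) = (\<integral>x. f x \<partial>Q)"
  for f :: "'x \<Rightarrow> real"
  by (subst law[of j, symmetric]) (simp add: integral_distr)

lemma AE_X:
  assumes "AE x in Q. R x"
  shows "AE \<omega> in P. \<forall>j. R (X j \<omega>)"
  unfolding AE_all_countable
proof
  fix j
  have "AE x in distr P borel (X j). R x" using assms by (simp only: law)
  then show "AE \<omega> in P. R (X j \<omega>)" by (rule AE_distrD[OF X_measurable])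
qed

lemma integrable_sample_mean:
  assumes "integrable Q f"
  shows "integrable P (\<lambda>\<omega>. sample_mean (\<lambda>j. X j \<omega>) f n)"
  unfolding sample_mean_def
  by (intro integrable_divide Bochner_Integration.integrable_sum integrable_X assms)

lemma sample_mean_L1_le:
  assumes f: "integrable Q f"
  shows "expectation (\<lambda>\<omega>. \<bar>sample_mean (\<lambda>j. X j \<omega>) f n\<bar>) \<le> (\<integral>x. \<bar>f x\<bar> \<partial>Q)"
proof (cases "n = 0")
  case True
  then show ?thesis by (simp add: sample_mean_def)
next
  case False
  have [measurable]: "f \<in> borel_measurable borel"
    using f by (rule borel_measurable_if_integrable)
  have f': "integrable Q (\<lambda>x. \<bar>f x\<bar>)" using f by simp
  have "expectation (\<lambda>\<omega>. \<bar>sample_mean (\<lambda>j. X j \<omega>) f n\<bar>)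
      \<le> expectation (\<lambda>\<omega>. sample_mean (\<lambda>j. X j \<omega>) (\<lambda>x. \<bar>f x\<bar>) n)"
  proof (intro integral_mono integrable_abs integrable_sample_mean f f')
    show "\<bar>sample_mean (\<lambda>j. X j \<omega>) f n\<bar> \<le> sample_mean (\<lambda>j. X j \<omega>) (\<lambda>x. \<bar>f x\<bar>) n" for \<omega>
      unfolding sample_mean_def by (simp add: divide_right_mono)
  qed
  also have "\<dots> = (\<integral>x. \<bar>f x\<bar> \<partial>Q)"
    unfolding sample_mean_def using False
    by (simp add: Bochner_Integration.integral_sum integrable_X[OF f'] integral_X[of "\<lambda>x. \<bar>f x\<bar>"])
  finally show ?thesis .
qed

text \<open>
  Independence and mean zero leave only the diagonal terms in the square of the sum, so the
  second moment decays like \<open>1 / n\<close>.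
\<close>

lemma sample_mean_second_moment:
  assumes meas: "f \<in> borel_measurable borel" and f2: "integrable Q (\<lambda>x. (f x)\<^sup>2)"
    and mean: "(\<integral>x. f x \<partial>Q) = 0"
  shows "integrable P (\<lambda>\<omega>. (sample_mean (\<lambda>j. X j \<omega>) f n)\<^sup>2)"
    and "expectation (\<lambda>\<omega>. (sample_mean (\<lambda>j. X j \<omega>) f n)\<^sup>2) = (\<integral>x. (f x)\<^sup>2 \<partial>Q) / real n"
proof -
  note [measurable] = meas
  interpret Q: prob_space Q by (rule prob_space_Q)
  have f: "integrable Q f"
    by (rule Q.square_integrable_imp_integrable[OF _ f2]) measurable
  have prod: "integrable P (\<lambda>\<omega>. f (X i \<omega>) * f (X j \<omega>)) \<and>
      expectation (\<lambda>\<omega>. f (X i \<omega>) * f (X j \<omega>)) = (if i = j then (\<integral>x. (f x)\<^sup>2 \<partial>Q) else 0)" for i j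
  proof (cases "i = j")
    case True
    then show ?thesis
      using integrable_X[OF f2, of j] integral_X[of "\<lambda>x. (f x)\<^sup>2" j] by (simp add: power2_eq_square)
  next
    case False
    have "indep_vars (\<lambda>_. borel) (\<lambda>l \<omega>. f (X l \<omega>)) {i, j}"
      by (rule indep_vars_compose2[OF indep_vars_subset[OF indep]]) auto
    note * = indep_vars_integrable[OF _ this] indep_vars_lebesgue_integral[OF _ this]
    show ?thesis
      using False * integrable_X[OF f] mean integral_X[OF meas] by simp
  qed
  have eq: "(sample_mean (\<lambda>j. X j \<omega>) f n)\<^sup>2 = (\<Sum>i<n. \<Sum>j<n. f (X i \<omega>) * f (X j \<omega>)) / (real n)\<^sup>2" for \<omega>
    by (simp add: sample_mean_def power_divide power2_eq_square sum_product)
  show "integrable P (\<lambda>\<omega>. (sample_mean (\<lambda>j. X j \<omega>) f n)\<^sup>2)"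
    unfolding eq using prod by (intro integrable_divide Bochner_Integration.integrable_sum) auto
  show "expectation (\<lambda>\<omega>. (sample_mean (\<lambda>j. X j \<omega>) f n)\<^sup>2) = (\<integral>x. (f x)\<^sup>2 \<partial>Q) / real n"
    unfolding eq using prod
    by (simp add: Bochner_Integration.integral_sum sum.delta power2_eq_square)
qed

text \<open>
  Truncation at a level \<open>k\<close> splits \<open>f\<close> into a bounded part \<open>g\<close>, whose sample mean converges in
  \<open>L\<^sup>2\<close>, and a rest that is small in \<open>L\<^sup>1\<close> uniformly in \<open>n\<close>.  Thus only a first moment is
  used, which is all that is available for the second derivatives.
\<close>

lemma weak_law_L1:
  assumes f: "integrable Q f"
  shows "(\<lambda>n. expectation (\<lambda>\<omega>. \<bar>sample_mean (\<lambda>j. X j \<omega>) f n - (\<integral>x. f x \<partial>Q)\<bar>)) \<longlonglongrightarrow> 0"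
proof (rule LIMSEQ_I)
  fix e :: real assume e: "e > 0"
  interpret Q: prob_space Q by (rule prob_space_Q)
  have [measurable]: "f \<in> borel_measurable borel"
    using f by (rule borel_measurable_if_integrable)
  have "(\<lambda>k. \<integral>x. \<bar>f x - (if \<bar>f x\<bar> \<le> real k then f x else 0)\<bar> \<partial>Q) \<longlonglongrightarrow> (\<integral>x. 0 \<partial>Q)"
  proof (rule integral_dominated_convergence[where w="\<lambda>x. \<bar>f x\<bar>"])
    show "AE x in Q. (\<lambda>k. \<bar>f x - (if \<bar>f x\<bar> \<le> real k then f x else 0)\<bar>) \<longlonglongrightarrow> 0"
    proof (rule AE_I2)
      fix x
      have "\<forall>\<^sub>F k in sequentially. \<bar>f x\<bar> \<le> real k"
        by (rule eventually_sequentiallyI[of "nat \<lceil>\<bar>f x\<bar>\<rceil>"]) linarith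
      then show "(\<lambda>k. \<bar>f x - (if \<bar>f x\<bar> \<le> real k then f x else 0)\<bar>) \<longlonglongrightarrow> 0"
        by (intro tendsto_eventually) (rule eventually_mono, assumption, simp)
    qed
  qed (use f in auto)
  then have "\<forall>\<^sub>F k in sequentially. (\<integral>x. \<bar>f x - (if \<bar>f x\<bar> \<le> real k then f x else 0)\<bar> \<partial>Q) < e / 3"
    by (rule order_tendstoD(2)) (use e in simp)
  then obtain k where k: "(\<integral>x. \<bar>f x - (if \<bar>f x\<bar> \<le> real k then f x else 0)\<bar> \<partial>Q) < e / 3"
    using eventually_happens'[OF sequentially_bot] by blast
  define g where "g x = (if \<bar>f x\<bar> \<le> real k then f x else 0)" for x
  have kg: "(\<integral>x. \<bar>f x - g x\<bar> \<partial>Q) < e / 3" using k by (simp only: g_def)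
  have [measurable]: "g \<in> borel_measurable borel" unfolding g_def by measurable
  have gk: "\<bar>g x\<bar> \<le> real k" for x by (auto simp: g_def)
  have g: "integrable Q g"
    by (rule Q.integrable_const_bound[of _ "real k"]) (use gk in auto)
  define m where "m = (\<integral>x. g x \<partial>Q)"
  define h where "h x = g x - m" for x
  have [measurable]: "h \<in> borel_measurable borel" unfolding h_def by measurable
  have hk: "\<bar>h x\<bar> \<le> real k + \<bar>m\<bar>" for x using gk[of x] by (auto simp: h_def)
  have h2: "integrable Q (\<lambda>x. (h x)\<^sup>2)"
    by (rule Q.integrable_const_bound[of _ "(real k + \<bar>m\<bar>)\<^sup>2"])
       (auto intro!: AE_I2 simp: abs_le_square_iff[symmetric] hk)
  have h0: "(\<integral>x. h x \<partial>Q) = 0"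
    unfolding h_def using g Q.prob_space by (simp add: m_def)
  have h1: "integrable Q h" unfolding h_def using g by simp
  define s where "s = (\<integral>x. (h x)\<^sup>2 \<partial>Q)"
  have "(\<lambda>n. sqrt (s / real n)) \<longlonglongrightarrow> sqrt 0"
    by (intro tendsto_real_sqrt lim_const_over_n)
  then have "\<forall>\<^sub>F n in sequentially. sqrt (s / real n) < e / 3"
    by (rule order_tendstoD(2)) (use e in simp)
  then obtain n0 where n0: "\<And>n. n \<ge> n0 \<Longrightarrow> sqrt (s / real n) < e / 3"
    by (auto simp: eventually_sequentially)
  have fg: "integrable Q (\<lambda>x. f x - g x)" using f g by simp
  have "norm (expectation (\<lambda>\<omega>. \<bar>sample_mean (\<lambda>j. X j \<omega>) f n - (\<integral>x. f x \<partial>Q)\<bar>) - 0) < e"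
    if n: "n \<ge> Suc n0" for n
  proof -
    let ?m = "\<lambda>f \<omega>. sample_mean (\<lambda>j. X j \<omega>) f n"
    have n_pos: "n > 0" using n by simp
    have hm: "?m h \<omega> = ?m g \<omega> - m" for \<omega>
      using n_pos by (simp add: h_def sample_mean_def sum_subtractf diff_divide_distrib)
    have tri: "\<bar>?m f \<omega> - (\<integral>x. f x \<partial>Q)\<bar>
        \<le> \<bar>?m (\<lambda>x. f x - g x) \<omega>\<bar> + \<bar>?m h \<omega>\<bar> + \<bar>m - (\<integral>x. f x \<partial>Q)\<bar>" for \<omega>
      unfolding hm sample_mean_diff by linarith
    have "expectation (\<lambda>\<omega>. \<bar>?m f \<omega> - (\<integral>x. f x \<partial>Q)\<bar>)
        \<le> expectation (\<lambda>\<omega>. \<bar>?m (\<lambda>x. f x - g x) \<omega>\<bar> + \<bar>?m h \<omega>\<bar> + \<bar>m - (\<integral>x. f x \<partial>Q)\<bar>)"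
      by (intro integral_mono tri)
         (intro Bochner_Integration.integrable_add Bochner_Integration.integrable_diff integrable_abs
            integrable_sample_mean f fg h1 integrable_const)+
    also have "\<dots> = expectation (\<lambda>\<omega>. \<bar>?m (\<lambda>x. f x - g x) \<omega>\<bar>) + expectation (\<lambda>\<omega>. \<bar>?m h \<omega>\<bar>)
        + \<bar>m - (\<integral>x. f x \<partial>Q)\<bar>"
      using integrable_sample_mean[OF fg, of n] integrable_sample_mean[OF h1, of n]
      by (simp add: prob_space)
    also have "expectation (\<lambda>\<omega>. \<bar>?m (\<lambda>x. f x - g x) \<omega>\<bar>) < e / 3"
      using sample_mean_L1_le[OF fg, of n] kg by simp
    also have "expectation (\<lambda>\<omega>. \<bar>?m h \<omega>\<bar>) < e / 3"
    proof -
      have "(expectation (\<lambda>\<omega>. \<bar>?m h \<omega>\<bar>))\<^sup>2 \<le> expectation (\<lambda>\<omega>. (\<bar>?m h \<omega>\<bar>)\<^sup>2)"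
      proof -
        have "0 \<le> variance (\<lambda>\<omega>. \<bar>?m h \<omega>\<bar>)" by (rule variance_positive)
        also have "\<dots> = expectation (\<lambda>\<omega>. (\<bar>?m h \<omega>\<bar>)\<^sup>2) - (expectation (\<lambda>\<omega>. \<bar>?m h \<omega>\<bar>))\<^sup>2"
          using integrable_sample_mean[OF h1, of n] sample_mean_second_moment(1)[OF _ h2 h0, of n]
          by (intro variance_eq) auto
        finally show ?thesis by simp
      qed
      also have "\<dots> = s / real n"
        using sample_mean_second_moment(2)[OF _ h2 h0, of n] by (simp add: s_def)
      finally have "expectation (\<lambda>\<omega>. \<bar>?m h \<omega>\<bar>) \<le> sqrt (s / real n)"
        by (rule real_le_rsqrt)
      then show ?thesis using n0[of n] n by simp
    qed
    also have "\<bar>m - (\<integral>x. f x \<partial>Q)\<bar> \<le> e / 3"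
    proof -
      have "m - (\<integral>x. f x \<partial>Q) = - (\<integral>x. f x - g x \<partial>Q)" using f g by (simp add: m_def)
      then show ?thesis
        using kg integral_abs_bound[of Q "\<lambda>x. f x - g x"] by linarith
    qed
    finally show ?thesis by simp
  qed
  then show "\<exists>no. \<forall>n\<ge>no. norm (expectation (\<lambda>\<omega>. \<bar>sample_mean (\<lambda>j. X j \<omega>) f n - (\<integral>x. f x \<partial>Q)\<bar>) - 0) < e"
    by blast
qed

lemma weak_law:
  assumes f: "integrable Q f" and e: "e > 0"
  shows "whp (\<lambda>n \<omega>. \<bar>sample_mean (\<lambda>j. X j \<omega>) f n - (\<integral>x. f x \<partial>Q)\<bar> < e)"
  by (intro whp_Markov weak_law_L1 f e) (auto intro!: integrable_sample_mean f)

text \<open>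
  The sample mean of a centred square integrable function is of order \<open>1 / sqrt n\<close>; its square
  is therefore negligible even after multiplication by \<open>sqrt n\<close>.
\<close>

lemma sample_mean_square_rate:
  assumes meas: "f \<in> borel_measurable borel" and f2: "integrable Q (\<lambda>x. (f x)\<^sup>2)"
    and mean: "(\<integral>x. f x \<partial>Q) = 0" and e: "e > 0"
  shows "whp (\<lambda>n \<omega>. sqrt (real n) * (sample_mean (\<lambda>j. X j \<omega>) f n)\<^sup>2 < e)"
proof (rule whp_Markov[OF _ _ _ e])
  show "integrable P (\<lambda>\<omega>. sqrt (real n) * (sample_mean (\<lambda>j. X j \<omega>) f n)\<^sup>2)" for n
    by (intro integrable_mult_right sample_mean_second_moment(1)[OF meas f2 mean])
  have "(\<lambda>n. sqrt (real n) * (s / real n)) \<longlonglongrightarrow> 0" for s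
  proof -
    have "(\<lambda>n. s / sqrt (real n)) \<longlonglongrightarrow> 0"
      by (intro tendsto_divide_0[OF tendsto_const] filterlim_at_top_imp_at_infinity
          filterlim_compose[OF sqrt_at_top filterlim_real_sequentially])
    then show ?thesis
      by (rule filterlim_mono_eventually) (auto simp: real_div_sqrt divide_simps)
  qed
  then show "(\<lambda>n. expectation (\<lambda>\<omega>. sqrt (real n) * (sample_mean (\<lambda>j. X j \<omega>) f n)\<^sup>2)) \<longlonglongrightarrow> 0"
    by (simp add: sample_mean_second_moment(2)[OF meas f2 mean])
qed auto

end

section \<open>Limit laws under negligible perturbations\<close>

lemma norm_iexp_diff_le: "norm (iexp a - iexp b) \<le> \<bar>a - b\<bar>"
proof -
  have "iexp a - iexp b = iexp b * (iexp (a - b) - 1)"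
    by (simp add: algebra_simps flip: exp_add)
  then have "norm (iexp a - iexp b) = norm (iexp (a - b) - 1)"
    by (simp add: norm_mult)
  also have "\<dots> \<le> \<bar>a - b\<bar>"
    using iexp_approx1[of "a - b" 0] by simp
  finally show ?thesis .
qed

lemma char_distr:
  "f \<in> borel_measurable M \<Longrightarrow> char (distr M borel f) t = (CLINT x|M. iexp (t * f x))"
  unfolding char_def by (rule integral_distr) auto

lemma char_normal_law: "char (normal_law 0 v) t = char std_normal_distribution (sqrt v * t)"
  unfolding normal_law_def char_def by (subst integral_distr) (auto simp: ac_simps)

lemma real_distribution_normal_law: "real_distribution (normal_law m v)"
proof -
  interpret real_distribution std_normal_distribution by (rule real_dist_normal_dist)
  show ?thesis unfolding normal_law_def by (rule real_distribution_distr) auto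
qed

context prob_space
begin

text \<open>
  Characteristic functions turn the claim into an estimate of \<open>E |exp(itZ) - exp(itY)|\<close>, which is
  at most \<open>|t| e\<close> on the event where \<open>Z\<close> and \<open>Y\<close> are within \<open>e\<close> and at most \<open>2\<close> elsewhere.
\<close>

lemma Slutsky:
  fixes Y Z :: "nat \<Rightarrow> 'a \<Rightarrow> real"
  assumes meas [measurable]: "\<And>n. random_variable borel (Y n)" "\<And>n. random_variable borel (Z n)"
    and L: "real_distribution L" and Y: "weak_conv_m (\<lambda>n. distr M borel (Y n)) L"
    and close: "\<And>e. e > 0 \<Longrightarrow> whp (\<lambda>n \<omega>. \<bar>Z n \<omega> - Y n \<omega>\<bar> < e)"
  shows "weak_conv_m (\<lambda>n. distr M borel (Z n)) L"
proof (rule levy_continuity[OF _ L])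
  show "real_distribution (distr M borel (Z n))" for n by simp
  fix t
  have Yt: "(\<lambda>n. char (distr M borel (Y n)) t) \<longlonglongrightarrow> char L t"
    by (rule levy_continuity1[OF _ L Y]) simp
  have "(\<lambda>n. char (distr M borel (Z n)) t - char (distr M borel (Y n)) t) \<longlonglongrightarrow> 0"
  proof (rule LIMSEQ_I)
    fix r :: real assume r: "r > 0"
    \<comment> \<open>The added \<open>1\<close> covers \<open>t = 0\<close>.\<close>
    define e where "e = r / (2 * (\<bar>t\<bar> + 1))"
    have e: "e > 0" "\<bar>t\<bar> * e < r / 2"
      using r by (simp_all add: e_def field_simps)
    obtain B where B: "\<And>n. B n \<in> events" "\<And>n \<omega>. \<omega> \<in> B n \<Longrightarrow> \<bar>Z n \<omega> - Y n \<omega>\<bar> < e"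
        "(\<lambda>n. prob (B n)) \<longlonglongrightarrow> 1"
      using close[OF e(1)] unfolding whp_def by blast
    have bound: "norm (char (distr M borel (Z n)) t - char (distr M borel (Y n)) t)
        \<le> \<bar>t\<bar> * e + 2 * (1 - prob (B n))" for n
    proof -
      note [measurable] = B(1)
      have int: "integrable M (\<lambda>\<omega>. iexp (t * W \<omega>))" if "random_variable borel W" for W
        using that by (intro integrable_iexp) auto
      have "char (distr M borel (Z n)) t - char (distr M borel (Y n)) t
          = (CLINT \<omega>|M. iexp (t * Z n \<omega>) - iexp (t * Y n \<omega>))"
        using int[of "Z n"] int[of "Y n"] by (simp add: char_distr)
      also have "norm \<dots> \<le> (\<integral>\<omega>. norm (iexp (t * Z n \<omega>) - iexp (t * Y n \<omega>)) \<partial>M)"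
        by (rule integral_norm_bound)
      also have "\<dots> \<le> (\<integral>\<omega>. \<bar>t\<bar> * e + 2 * indicator (space M - B n) \<omega> \<partial>M)"
      proof (rule integral_mono)
        show "integrable M (\<lambda>\<omega>. norm (iexp (t * Z n \<omega>) - iexp (t * Y n \<omega>)))"
          using int[of "Z n"] int[of "Y n"] by (intro integrable_norm Bochner_Integration.integrable_diff) auto
        show "integrable M (\<lambda>\<omega>. \<bar>t\<bar> * e + 2 * indicator (space M - B n) \<omega>)"
          using B(1) by (intro Bochner_Integration.integrable_add integrable_mult_right) (auto simp: emeasure_eq_measure)
        fix \<omega> assume \<omega>: "\<omega> \<in> space M"
        show "norm (iexp (t * Z n \<omega>) - iexp (t * Y n \<omega>)) \<le> \<bar>t\<bar> * e + 2 * indicator (space M - B n) \<omega>"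
        proof (cases "\<omega> \<in> B n")
          case True
          have "norm (iexp (t * Z n \<omega>) - iexp (t * Y n \<omega>)) \<le> \<bar>t * Z n \<omega> - t * Y n \<omega>\<bar>"
            by (rule norm_iexp_diff_le)
          also have "\<dots> = \<bar>t\<bar> * \<bar>Z n \<omega> - Y n \<omega>\<bar>" by (simp add: abs_mult flip: right_diff_distrib)
          also have "\<dots> \<le> \<bar>t\<bar> * e" using B(2)[OF True] by (intro mult_left_mono) auto
          finally show ?thesis using True by simp
        next
          case False
          have "norm (iexp (t * Z n \<omega>) - iexp (t * Y n \<omega>)) \<le> 2"
            using norm_triangle_ineq4[of "iexp (t * Z n \<omega>)" "iexp (t * Y n \<omega>)"] by simp
          moreover have "0 \<le> \<bar>t\<bar> * e" using e by simp
          ultimately show ?thesis using False \<omega> by simp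
        qed
      qed
      also have "\<dots> = \<bar>t\<bar> * e + 2 * (1 - prob (B n))"
        using B(1) by (subst Bochner_Integration.integral_add) (auto simp: prob_space prob_compl emeasure_eq_measure)
      finally show ?thesis .
    qed
    have "(\<lambda>n. \<bar>t\<bar> * e + 2 * (1 - prob (B n))) \<longlonglongrightarrow> \<bar>t\<bar> * e + 2 * (1 - 1)"
      by (intro tendsto_intros B)
    then have "\<forall>\<^sub>F n in sequentially. \<bar>t\<bar> * e + 2 * (1 - prob (B n)) < r"
      by (rule order_tendstoD(2)) (use e r in simp)
    then have "\<forall>\<^sub>F n in sequentially. norm (char (distr M borel (Z n)) t - char (distr M borel (Y n)) t - 0) < r"
      by (rule eventually_mono) (simp only: diff_zero, rule le_less_trans[OF bound])
    then show "\<exists>no. \<forall>n\<ge>no. norm (char (distr M borel (Z n)) t - char (distr M borel (Y n)) t - 0) < r"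
      by (simp only: eventually_sequentially)
  qed
  from tendsto_add[OF this Yt]
  show "(\<lambda>n. char (distr M borel (Z n)) t) \<longlonglongrightarrow> char L t" by simp
qed

end

context iid_sample
begin

text \<open>
  The classical central limit theorem, rescaled so that the variance appears in the limit.  If
  the variance vanishes, \<open>f (X j)\<close> is almost surely constant and the limit is the point mass.
\<close>

lemma central_limit_sample_mean:
  assumes meas [measurable]: "f \<in> borel_measurable borel" and f2: "integrable Q (\<lambda>x. (f x)\<^sup>2)"
  shows "weak_conv_m (\<lambda>n. distr P borel
      (\<lambda>\<omega>. sqrt (real n) * (sample_mean (\<lambda>j. X j \<omega>) f n - (\<integral>x. f x \<partial>Q))))
    (normal_law 0 (variance (\<lambda>\<omega>. f (X 0 \<omega>))))"
proof -
  interpret Q: prob_space Q by (rule prob_space_Q)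
  define m where "m = (\<integral>x. f x \<partial>Q)"
  define v where "v = variance (\<lambda>\<omega>. f (X 0 \<omega>))"
  have f: "integrable Q f"
    by (rule Q.square_integrable_imp_integrable[OF _ f2]) measurable
  have EX: "expectation (\<lambda>\<omega>. f (X j \<omega>)) = m" for j
    by (simp add: integral_X m_def)
  have var: "variance (\<lambda>\<omega>. f (X j \<omega>)) = v" for j
    using integral_X[of "\<lambda>x. (f x - m)\<^sup>2"] by (simp add: v_def EX)
  define D where "D n \<omega> = sqrt (real n) * (sample_mean (\<lambda>j. X j \<omega>) f n - m)" for n \<omega>
  have D_meas [measurable]: "D n \<in> borel_measurable P" for n
    unfolding D_def sample_mean_def by measurable
  have "(\<lambda>n. char (distr P borel (D n)) t) \<longlonglongrightarrow> char (normal_law 0 v) t" for t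
  proof (cases "v = 0")
    case True
    have "AE \<omega> in P. f (X j \<omega>) = m" for j
    proof -
      have i: "integrable P (\<lambda>\<omega>. (f (X j \<omega>) - m)\<^sup>2)"
        using integrable_X[OF f2, of j] integrable_X[OF f, of j] by (simp add: power2_diff)
      have "expectation (\<lambda>\<omega>. (f (X j \<omega>) - m)\<^sup>2) = 0" using var[of j] True EX by simp
      then have "AE \<omega> in P. (f (X j \<omega>) - m)\<^sup>2 = 0"
        by (subst (asm) integral_nonneg_eq_0_iff_AE[OF i]) auto
      then show ?thesis by (rule AE_mp) simp
    qed
    then have *: "AE \<omega> in P. \<forall>j. f (X j \<omega>) = m" by (simp add: AE_all_countable)
    have D0: "AE \<omega> in P. D n \<omega> = 0" for n
      using * by (rule AE_mp) (auto simp: D_def sample_mean_def)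
    have "AE \<omega> in P. iexp (t * D n \<omega>) = 1" for n
      using D0[of n] by (rule eventually_mono) simp
    then have "(CLINT \<omega>|P. iexp (t * D n \<omega>)) = (CLINT \<omega>|P. 1)" for n
      by (intro integral_cong_AE) auto
    then have "char (distr P borel (D n)) t = 1" for n
      by (simp add: char_distr prob_space)
    moreover have "char (normal_law 0 v) t = 1"
      unfolding char_normal_law True using real_distribution.char_zero[OF real_dist_normal_dist] by simp
    ultimately show ?thesis by simp
  next
    case False
    have "v \<ge> 0" unfolding v_def by (rule variance_positive)
    with False have v: "v > 0" by simp
    let ?S = "\<lambda>n \<omega>. (\<Sum>i<n. f (X i \<omega>) - m) / sqrt (real n * (sqrt v)\<^sup>2)"
    have "weak_conv_m (\<lambda>n. distr P borel (?S n)) std_normal_distribution"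
    proof (rule central_limit_theorem[where \<mu>="distr Q borel f"])
      show "indep_vars (\<lambda>i. borel) (\<lambda>i \<omega>. f (X i \<omega>)) UNIV"
        by (rule indep_vars_compose2[OF indep]) auto
      show "integrable P (\<lambda>\<omega>. (f (X n \<omega>))\<^sup>2)" for n by (rule integrable_X[OF f2])
      show "distr P borel (\<lambda>\<omega>. f (X n \<omega>)) = distr Q borel f" for n
        by (subst law[of n, symmetric]) (simp add: distr_distr comp_def)
    qed (use v EX var in auto)
    from levy_continuity1[OF _ real_dist_normal_dist this, of "sqrt v * t"]
    have "(\<lambda>n. char (distr P borel (?S n)) (sqrt v * t)) \<longlonglongrightarrow> char (normal_law 0 v) t"
      by (simp add: char_normal_law)
    moreover have "D n \<omega> = sqrt v * ?S n \<omega>" for n \<omega>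
    proof (cases "n = 0")
      case False
      then have "sample_mean (\<lambda>j. X j \<omega>) f n - m = (\<Sum>i<n. f (X i \<omega>) - m) / real n"
        by (simp add: sample_mean_def sum_subtractf diff_divide_distrib)
      moreover have "sqrt (real n) * (a / real n) = sqrt v * (a / sqrt (real n * (sqrt v)\<^sup>2))" for a
        using v False by (simp add: real_sqrt_mult field_simps)
      ultimately show ?thesis by (simp add: D_def)
    qed (simp add: D_def)
    ultimately show ?thesis
      by (simp add: char_distr mult.assoc mult.left_commute)
  qed
  then have "weak_conv_m (\<lambda>n. distr P borel (D n)) (normal_law 0 v)"
    by (intro levy_continuity real_distribution_normal_law) auto
  then show ?thesis by (simp add: D_def[abs_def] m_def v_def)
qed

end

section \<open>A lower bound for the sample Frechet function, uniform over the whole space\<close>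

text \<open>
  A squared triangle inequality whose leading factor \<open>1 + t\<close> can be brought close to one, at the
  price of a large factor in front of the term that will be made small.  It replaces Minkowski's
  inequality for the distances of order two.
\<close>

lemma square_add_le_weighted:
  fixes a b t :: real
  assumes "t > 0"
  shows "(a + b)\<^sup>2 \<le> (1 + t) * a\<^sup>2 + (1 + 1 / t) * b\<^sup>2"
proof -
  have "0 \<le> (t * a - b)\<^sup>2 / t" using assms by simp
  also have "\<dots> = (1 + t) * a\<^sup>2 + (1 + 1 / t) * b\<^sup>2 - (a + b)\<^sup>2"
    using assms by (simp add: field_simps power2_eq_square)
  finally show ?thesis by simp
qed

lemma dist_square_le_weighted:
  fixes x y z :: "'a::metric_space"
  assumes "t > 0"
  shows "(dist x z)\<^sup>2 \<le> (1 + t) * (dist y z)\<^sup>2 + (1 + 1 / t) * (dist x y)\<^sup>2"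
proof -
  have "(dist x z)\<^sup>2 \<le> (dist y z + dist x y)\<^sup>2"
    using dist_triangle[of x z y] by (intro power_mono) auto
  also have "\<dots> \<le> (1 + t) * (dist y z)\<^sup>2 + (1 + 1 / t) * (dist x y)\<^sup>2"
    by (rule square_add_le_weighted[OF assms])
  finally show ?thesis .
qed

text \<open>
  The identity is a pointwise limit of finitely valued maps \<open>F i\<close> that move \<open>x\<close> by at most three
  times its distance to a base point, so dominated convergence applies.
\<close>

lemma exists_finite_quantizer:
  fixes Q :: "'m::{metric_space, second_countable_topology} measure"
  assumes Q: "prob_space Q" and sets_Q [measurable_cong]: "sets Q = sets borel"
    and int: "\<And>p. integrable Q (\<lambda>x. (dist p x)\<^sup>2)" and r: "r > 0"
  obtains T where "finite (range T)" "T \<in> measurable borel borel"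
    "integrable Q (\<lambda>x. (dist (T x) x)\<^sup>2)" "(\<integral>x. (dist (T x) x)\<^sup>2 \<partial>Q) < r"
proof -
  interpret prob_space Q by fact
  have space_Q: "space Q = UNIV" using sets_Q by (metis sets_eq_imp_space_eq space_borel)
  \<comment> \<open>An arbitrary base point.\<close>
  obtain z :: 'm where True by blast
  have "(\<lambda>x. x) \<in> measurable Q borel" by measurable
  from borel_measurable_implies_sequence_metric[OF this, of z]
  obtain F where F: "\<And>i. simple_function Q (F i)" "\<And>x. (\<lambda>i. F i x) \<longlonglongrightarrow> x"
    "\<And>i x. dist (F i x) z \<le> 2 * dist x z"
    unfolding space_Q by auto
  have [measurable]: "F i \<in> measurable borel borel" for i
    using borel_measurable_simple_function[OF F(1)] measurable_cong_sets[OF sets_Q refl] by blast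
  have b: "(dist (F i x) x)\<^sup>2 \<le> 9 * (dist z x)\<^sup>2" for i x
  proof -
    have "dist (F i x) x \<le> 3 * dist z x"
      using dist_triangle2[of "F i x" x z] F(3)[of i x] by (simp add: dist_commute)
    then have "(dist (F i x) x)\<^sup>2 \<le> (3 * dist z x)\<^sup>2" by (intro power_mono) auto
    then show ?thesis by (simp add: power_mult_distrib)
  qed
  have lim: "(\<lambda>i. (dist (F i x) x)\<^sup>2) \<longlonglongrightarrow> 0" for x
    using tendsto_power[OF tendsto_dist[OF F(2) tendsto_const], of x x 2] by simp
  have "(\<lambda>i. \<integral>x. (dist (F i x) x)\<^sup>2 \<partial>Q) \<longlonglongrightarrow> (\<integral>x. 0 \<partial>Q)"
    by (rule integral_dominated_convergence[where w="\<lambda>x. 9 * (dist z x)\<^sup>2"])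
       (use int b lim in auto)
  then have "\<forall>\<^sub>F i in sequentially. (\<integral>x. (dist (F i x) x)\<^sup>2 \<partial>Q) < r"
    by (rule order_tendstoD(2)) (use r in simp)
  then obtain i where i: "(\<integral>x. (dist (F i x) x)\<^sup>2 \<partial>Q) < r"
    using eventually_happens'[OF sequentially_bot] by blast
  show ?thesis
  proof (rule that[of "F i"])
    show "finite (range (F i))" using F(1)[of i] by (simp add: simple_function_def space_Q)
    show "integrable Q (\<lambda>x. (dist (F i x) x)\<^sup>2)"
      by (rule Bochner_Integration.integrable_bound[where f="\<lambda>x. 9 * (dist z x)\<^sup>2"])
         (use int b in auto)
  qed (use i in auto)
qed

lemma sum_indicator_vimage:
  fixes g :: "'b \<Rightarrow> real"
  assumes "finite (range T)"
  shows "g (T x) = (\<Sum>y\<in>range T. g y * indicator (T -` {y}) x)"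
proof -
  have "(\<Sum>y\<in>range T. g y * indicator (T -` {y}) x) = (\<Sum>y\<in>range T. if y = T x then g y else 0)"
    by (rule sum.cong) (auto simp: indicator_def)
  then show ?thesis using assms by simp
qed

text \<open>
  If the sample points are rounded to the finitely many values of a quantizer \<open>T\<close>, the sample
  Frechet function becomes a combination of the functions \<open>p \<mapsto> \<rho>\<^sup>2(y, p)\<close>, \<open>y\<close> in the range of
  \<open>T\<close>, weighted by empirical frequencies.  With high probability each frequency is at least
  \<open>1 - s\<close> times its probability.  This is a multiplicative bound, hence uniform in \<open>p\<close>, no matter
  how far away \<open>p\<close> is.  Rounding costs factors \<open>1 + s\<close> and additive errors of order \<open>s\<close>.
\<close>

lemma sample_frechet_lower_bound_whp:
  fixes X :: "nat \<Rightarrow> 'w \<Rightarrow> 'm::{metric_space, second_countable_topology}" and c \<delta> :: real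
  assumes iid: "iid_sample P X Q"
    and int: "\<And>p. integrable Q (\<lambda>x. (dist x p)\<^sup>2)"
    and \<delta>: "\<delta> > 0" and S: "\<And>p. p \<in> S \<Longrightarrow> c + \<delta> \<le> (\<integral>x. (dist x p)\<^sup>2 \<partial>Q)"
  shows "prob_space.whp P (\<lambda>n \<omega>. \<forall>p\<in>S. c < sample_mean (\<lambda>j. X j \<omega>) (\<lambda>x. (dist x p)\<^sup>2) n)"
proof -
  interpret iid_sample P X Q by fact
  interpret Q: prob_space Q by (rule prob_space_Q)
  \<comment> \<open>The lower bound that the argument below yields with rounding error \<open>s\<^sup>2\<close>; at \<open>s = 0\<close> it is
    \<open>c + \<delta>\<close>, so some positive \<open>s\<close> keeps it above \<open>c\<close>.\<close>
  let ?b = "\<lambda>s. ((1 - s) * ((c + \<delta> - (s\<^sup>2 + s)) / (1 + s)) - 2 * (s\<^sup>2 + s)) / (1 + s)"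
  have "(?b \<longlongrightarrow> ((1 - 0) * ((c + \<delta> - (0\<^sup>2 + 0)) / (1 + 0)) - 2 * (0\<^sup>2 + 0)) / (1 + 0)) (at_right 0)"
    by (intro tendsto_intros) auto
  then have "\<forall>\<^sub>F s in at_right 0. c < ?b s"
    by (rule order_tendstoD(1)) (use \<delta> in simp)
  moreover have "\<forall>\<^sub>F s in at_right 0. s < (1::real)"
    by (rule eventually_at_rightI[of 0 1]) auto
  moreover have "\<forall>\<^sub>F s in at_right 0. s > (0::real)"
    by (rule eventually_at_right_less)
  ultimately have "\<forall>\<^sub>F s in at_right (0::real). c < ?b s \<and> s < 1 \<and> 0 < s"
    by eventually_elim simp
  then obtain s where s: "0 < s" "s < 1" and b: "c < ?b s"
    using eventually_happens'[OF trivial_limit_at_right_real] by blast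
  have s2: "(1 + 1 / s) * (k * s\<^sup>2) = k * (s\<^sup>2 + s)" for k
    using s by (simp add: field_simps power2_eq_square)
  obtain T where T: "finite (range T)" and T_meas [measurable]: "T \<in> measurable borel borel"
    and Tint: "integrable Q (\<lambda>x. (dist (T x) x)\<^sup>2)" and TR: "(\<integral>x. (dist (T x) x)\<^sup>2 \<partial>Q) < s\<^sup>2"
    using exists_finite_quantizer[OF prob_space_Q sets_Q, of "s\<^sup>2"] int s
    by (metis (no_types, lifting) dist_commute ext zero_less_power)
  define q where "q y = measure Q (T -` {y})" for y
  define freq where "freq n \<omega> y = sample_mean (\<lambda>j. X j \<omega>) (indicator (T -` {y})) n" for n \<omega> y
  have cell: "T -` {y} \<in> sets Q" for y
    using measurable_sets[OF T_meas, of "{y}"] by (simp add: sets_Q)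
  have ind_int: "integrable Q (indicator (T -` {y}) :: _ \<Rightarrow> real)" for y
    using cell by (simp add: Q.emeasure_eq_measure)
  have freq_whp: "whp (\<lambda>n \<omega>. (1 - s) * q y \<le> freq n \<omega> y)" for y
  proof (cases "q y = 0")
    case True
    then show ?thesis
      by (intro whp_eventually always_eventually) (simp add: freq_def sample_mean_nonneg)
  next
    case False
    then have "q y > 0" by (simp add: q_def zero_less_measure_iff)
    then have "whp (\<lambda>n \<omega>. \<bar>freq n \<omega> y - q y\<bar> < s * q y)"
      using weak_law[OF ind_int, of "s * q y" y] s cell by (simp add: freq_def q_def)
    then show ?thesis by (rule whp_mono) (auto simp: algebra_simps)
  qed
  have "whp (\<lambda>n \<omega>. (\<forall>y\<in>range T. (1 - s) * q y \<le> freq n \<omega> y) \<and>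
      \<bar>sample_mean (\<lambda>j. X j \<omega>) (\<lambda>x. (dist (T x) x)\<^sup>2) n - (\<integral>x. (dist (T x) x)\<^sup>2 \<partial>Q)\<bar> < s\<^sup>2)"
    using s by (intro whp_conj[OF whp_ball_finite[OF T freq_whp] weak_law[OF Tint]]) simp
  then show ?thesis
  proof (rule whp_mono, intro ballI)
    fix n \<omega> p
    assume "p \<in> S" and *: "(\<forall>y\<in>range T. (1 - s) * q y \<le> freq n \<omega> y) \<and>
      \<bar>sample_mean (\<lambda>j. X j \<omega>) (\<lambda>x. (dist (T x) x)\<^sup>2) n - (\<integral>x. (dist (T x) x)\<^sup>2 \<partial>Q)\<bar> < s\<^sup>2"
    let ?m = "\<lambda>f. sample_mean (\<lambda>j. X j \<omega>) f n"
    define G where "G = (\<Sum>y\<in>range T. (dist y p)\<^sup>2 * q y)"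
    have G_eq: "(\<integral>x. (dist (T x) p)\<^sup>2 \<partial>Q) = G" and G_int: "integrable Q (\<lambda>x. (dist (T x) p)\<^sup>2)"
      unfolding sum_indicator_vimage[OF T, of "\<lambda>y. (dist y p)\<^sup>2"] G_def q_def
      using ind_int cell by (auto simp: Bochner_Integration.integral_sum)
    have Gn_eq: "?m (\<lambda>x. (dist (T x) p)\<^sup>2) = (\<Sum>y\<in>range T. (dist y p)\<^sup>2 * freq n \<omega> y)"
      unfolding sum_indicator_vimage[OF T, of "\<lambda>y. (dist y p)\<^sup>2"] freq_def
      by (simp add: sample_mean_sum sample_mean_cmult)
    have Gn: "(1 - s) * G \<le> ?m (\<lambda>x. (dist (T x) p)\<^sup>2)"
      unfolding Gn_eq G_def sum_distrib_left
      using * by (intro sum_mono) (metis mult.left_commute mult_left_mono zero_le_power2)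
    have "(\<integral>x. (dist x p)\<^sup>2 \<partial>Q) \<le> (\<integral>x. (1 + s) * (dist (T x) p)\<^sup>2 + (1 + 1 / s) * (dist (T x) x)\<^sup>2 \<partial>Q)"
      by (intro integral_mono int Bochner_Integration.integrable_add integrable_mult_right G_int Tint)
         (metis dist_square_le_weighted[OF s(1)] dist_commute)
    also have "\<dots> = (1 + s) * G + (1 + 1 / s) * (\<integral>x. (dist (T x) x)\<^sup>2 \<partial>Q)"
      using G_int Tint by (simp add: G_eq)
    also have "\<dots> \<le> (1 + s) * G + (1 + 1 / s) * (1 * s\<^sup>2)"
      using TR s by (intro add_left_mono mult_left_mono) auto
    finally have "c + \<delta> - (s\<^sup>2 + s) \<le> (1 + s) * G"
      using S[OF \<open>p \<in> S\<close>] unfolding s2 by simp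
    then have 1: "(c + \<delta> - (s\<^sup>2 + s)) / (1 + s) \<le> G"
      using s by (simp add: pos_divide_le_eq mult.commute)
    have "?m (\<lambda>x. (dist (T x) p)\<^sup>2) \<le> ?m (\<lambda>x. (1 + s) * (dist x p)\<^sup>2 + (1 + 1 / s) * (dist (T x) x)\<^sup>2)"
      by (rule sample_mean_mono) (rule dist_square_le_weighted[OF s(1)])
    also have "\<dots> = (1 + s) * ?m (\<lambda>x. (dist x p)\<^sup>2) + (1 + 1 / s) * ?m (\<lambda>x. (dist (T x) x)\<^sup>2)"
      by (simp only: sample_mean_add sample_mean_cmult)
    also have "\<dots> \<le> (1 + s) * ?m (\<lambda>x. (dist x p)\<^sup>2) + (1 + 1 / s) * (2 * s\<^sup>2)"
      using TR s * by (intro add_left_mono mult_left_mono) auto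
    finally have "(1 - s) * G \<le> (1 + s) * ?m (\<lambda>x. (dist x p)\<^sup>2) + 2 * (s\<^sup>2 + s)"
      using Gn unfolding s2 by linarith
    moreover have "(1 - s) * ((c + \<delta> - (s\<^sup>2 + s)) / (1 + s)) \<le> (1 - s) * G"
      using 1 s by (intro mult_left_mono) auto
    ultimately have "(1 - s) * ((c + \<delta> - (s\<^sup>2 + s)) / (1 + s)) - 2 * (s\<^sup>2 + s)
        \<le> ?m (\<lambda>x. (dist x p)\<^sup>2) * (1 + s)"
      by (simp only: mult.commute[of "?m (\<lambda>x. (dist x p)\<^sup>2)"])
    then have "?b s \<le> ?m (\<lambda>x. (dist x p)\<^sup>2)"
      by (subst pos_divide_le_eq) (use s in auto)
    with b show "c < ?m (\<lambda>x. (dist x p)\<^sup>2)" by linarith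
  qed
qed

section \<open>The sample Frechet variation as a random variable\<close>

text \<open>
  This reduces the infimum over all points to a countable one, so that the sample Frechet
  variation is measurable.
\<close>

lemma INF_dense_eq:
  fixes f :: "'a::topological_space \<Rightarrow> real"
  assumes cont: "continuous_on UNIV f" and bdd: "\<And>p. b \<le> f p"
    and D: "closure D = UNIV"
  shows "(INF p. f p) = (INF p\<in>D. f p)"
proof (rule antisym)
  have ne: "D \<noteq> {}" using D by auto
  have bD: "bdd_below (f ` D)" and bU: "bdd_below (range f)" using bdd by (auto simp: bdd_below_def)
  show "(INF p. f p) \<le> (INF p\<in>D. f p)"
    by (rule cINF_superset_mono) (use ne bU in auto)
  have "closure D \<subseteq> {p. (INF p\<in>D. f p) \<le> f p}"
    by (rule closure_minimal) (auto intro!: closed_Collect_le cont cINF_lower bD continuous_on_const)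
  then show "(INF p\<in>D. f p) \<le> (INF p. f p)"
    using D by (intro cINF_greatest) auto
qed

lemma sample_frechet_fun_eq_sample_mean:
  "sample_frechet_fun x n p = sample_mean x (\<lambda>y. (dist y p)\<^sup>2) n"
  by (simp add: sample_frechet_fun_def sample_mean_def)

lemma sample_frechet_fun_nonneg: "0 \<le> sample_frechet_fun x n p"
  unfolding sample_frechet_fun_eq_sample_mean by (intro sample_mean_nonneg) simp

lemma sample_frechet_variation_le: "sample_frechet_variation x n \<le> sample_frechet_fun x n p"
  unfolding sample_frechet_variation_def
  by (rule cINF_lower[OF bdd_belowI2[of _ 0]]) (simp_all add: sample_frechet_fun_nonneg)

lemma sample_frechet_variation_ge:
  "(\<And>p. b \<le> sample_frechet_fun x n p) \<Longrightarrow> b \<le> sample_frechet_variation x n"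
  unfolding sample_frechet_variation_def by (rule cINF_greatest) auto

lemma sample_frechet_variation_measurable:
  fixes X :: "nat \<Rightarrow> 'w \<Rightarrow> 'm::{metric_space, second_countable_topology}"
  assumes [measurable]: "\<And>j. X j \<in> measurable P borel"
  shows "(\<lambda>\<omega>. sample_frechet_variation (\<lambda>j. X j \<omega>) n) \<in> borel_measurable P"
proof -
  obtain D :: "'m set" where "countable D" and D: "\<And>S. open S \<Longrightarrow> S \<noteq> {} \<Longrightarrow> \<exists>d\<in>D. d \<in> S"
    by (rule countable_dense_setE) blast
  have "closure D = UNIV"
    using D[of "- closure D"] closure_subset[of D] by auto
  moreover have "continuous_on UNIV (sample_frechet_fun x n)" for x :: "nat \<Rightarrow> 'm"
    unfolding sample_frechet_fun_def divide_inverse by (intro continuous_intros)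
  ultimately have "sample_frechet_variation (\<lambda>j. X j \<omega>) n = (INF p\<in>D. sample_frechet_fun (\<lambda>j. X j \<omega>) n p)" for \<omega>
    unfolding sample_frechet_variation_def
    by (intro INF_dense_eq[where b=0] sample_frechet_fun_nonneg)
  moreover have "(\<lambda>\<omega>. INF p\<in>D. sample_frechet_fun (\<lambda>j. X j \<omega>) n p) \<in> borel_measurable P"
  proof (rule borel_measurable_cINF)
    show "(\<lambda>\<omega>. sample_frechet_fun (\<lambda>j. X j \<omega>) n p) \<in> borel_measurable P" for p
      unfolding sample_frechet_fun_def by measurable
    show "bdd_below ((\<lambda>p. sample_frechet_fun (\<lambda>j. X j \<omega>) n p) ` D)" for \<omega>
      by (rule bdd_belowI2[of _ 0]) (rule sample_frechet_fun_nonneg)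
  qed fact
  ultimately show ?thesis by simp
qed

section \<open>Second order calculus in coordinates\<close>

definition hessian :: "(real^'d \<Rightarrow> real) \<Rightarrow> real^'d \<Rightarrow> real^'d^'d" where
  "hessian f y = (\<chi> r s. partial_deriv s (partial_deriv r f) y)"

lemma inner_matrix_vector_eq_sum:
  "w \<bullet> (A *v w) = (\<Sum>r\<in>UNIV. \<Sum>s\<in>UNIV. w $ r * w $ s * A $ r $ s)" for w :: "real^'d"
  by (simp add: inner_vec_def matrix_vector_mult_def sum_distrib_left mult_ac)

lemma abs_inner_matrix_vector_le:
  "\<bar>w \<bullet> (A *v w)\<bar> \<le> (\<Sum>r\<in>UNIV. \<Sum>s\<in>UNIV. \<bar>A $ r $ s\<bar>) * (norm w)\<^sup>2" for w :: "real^'d"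
proof -
  have "\<bar>w $ r * w $ s * A $ r $ s\<bar> \<le> \<bar>A $ r $ s\<bar> * (norm w)\<^sup>2" for r s
  proof -
    have "\<bar>w $ r\<bar> * \<bar>w $ s\<bar> \<le> norm w * norm w"
      by (intro mult_mono component_le_norm_cart) auto
    then have "\<bar>w $ r\<bar> * \<bar>w $ s\<bar> * \<bar>A $ r $ s\<bar> \<le> norm w * norm w * \<bar>A $ r $ s\<bar>"
      by (intro mult_right_mono) auto
    then show ?thesis by (simp add: abs_mult power2_eq_square mult_ac)
  qed
  then have "\<bar>w \<bullet> (A *v w)\<bar> \<le> (\<Sum>r\<in>UNIV. \<Sum>s\<in>UNIV. \<bar>A $ r $ s\<bar> * (norm w)\<^sup>2)"
    unfolding inner_matrix_vector_eq_sum
    by (intro order_trans[OF sum_abs] sum_mono)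
  then show ?thesis by (simp add: sum_distrib_right)
qed

lemma has_real_derivative_along_line:
  assumes "f differentiable (at (y + t *\<^sub>R v))"
  shows "((\<lambda>t. f (y + t *\<^sub>R v)) has_real_derivative frechet_derivative f (at (y + t *\<^sub>R v)) v) (at t)"
proof -
  let ?D = "frechet_derivative f (at (y + t *\<^sub>R v))"
  have D: "(f has_derivative ?D) (at (y + t *\<^sub>R v))"
    using assms by (simp add: frechet_derivative_works)
  have "((\<lambda>t. f (y + t *\<^sub>R v)) has_derivative (\<lambda>h. ?D (h *\<^sub>R v))) (at t)"
    by (rule has_derivative_compose[of "\<lambda>t. y + t *\<^sub>R v", OF _ D]) (auto intro!: derivative_eq_intros)
  moreover have "?D (h *\<^sub>R v) = ?D v * h" for h
    using linear_scale[OF has_derivative_linear[OF D]] by (simp add: mult.commute)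
  ultimately show ?thesis by (simp add: has_field_derivative_def)
qed

lemma partial_deriv_eq_frechet_derivative:
  assumes "f differentiable (at y)"
  shows "partial_deriv r f y = frechet_derivative f (at y) (axis r 1)"
  unfolding partial_deriv_def
  using has_real_derivative_along_line[of f y 0 "axis r 1"] assms by (intro DERIV_imp_deriv) simp

lemma has_real_derivative_along_line_gradient:
  assumes "f differentiable (at (y + t *\<^sub>R w))"
  shows "((\<lambda>t. f (y + t *\<^sub>R w)) has_real_derivative (\<Sum>r\<in>UNIV. w $ r * partial_deriv r f (y + t *\<^sub>R w))) (at t)"
proof -
  let ?D = "frechet_derivative f (at (y + t *\<^sub>R w))"
  have lin: "linear ?D"
    using assms by (intro has_derivative_linear) (simp add: frechet_derivative_works)
  have "w = (\<Sum>r\<in>UNIV. w $ r *\<^sub>R axis r 1)"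
    using basis_expansion[of w] by (simp add: scalar_mult_eq_scaleR)
  then have "?D w = ?D (\<Sum>r\<in>UNIV. w $ r *\<^sub>R axis r 1)"
    by (rule arg_cong)
  also have "\<dots> = (\<Sum>r\<in>UNIV. w $ r * ?D (axis r 1))"
    by (simp add: linear_sum[OF lin] linear_scale[OF lin])
  finally show ?thesis
    using has_real_derivative_along_line[OF assms] partial_deriv_eq_frechet_derivative[OF assms] by simp
qed

lemma has_real_derivative_along_axis:
  assumes "f differentiable (at (y + t *\<^sub>R axis r 1))"
  shows "((\<lambda>t. f (y + t *\<^sub>R axis r 1)) has_real_derivative partial_deriv r f (y + t *\<^sub>R axis r 1)) (at t)"
  using has_real_derivative_along_line[OF assms] partial_deriv_eq_frechet_derivative[OF assms] by simp

text \<open>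
  The iterated partial derivatives are derivatives along coordinate lines, whereas \<open>Ck_on\<close> speaks
  of iterated Frechet derivatives.  The two agree at every point of the open set \<open>N\<close>, and
  openness of \<open>N\<close> is what lets one differentiate this agreement once more.
\<close>

lemma Ck_on_2_partial_derivs:
  fixes f :: "real^'d \<Rightarrow> real"
  assumes f: "Ck_on 2 f N" and N: "open N"
  shows Ck_on_2_differentiable: "\<And>y. y \<in> N \<Longrightarrow> f differentiable (at y)"
    and Ck_on_2_partial_deriv_differentiable: "\<And>y r. y \<in> N \<Longrightarrow> partial_deriv r f differentiable (at y)"
    and Ck_on_2_continuous_second: "\<And>r s. continuous_on N (partial_deriv s (partial_deriv r f))"
proof -
  let ?g = "\<lambda>r y. frechet_derivative f (at y) (axis r 1)"
  have d: "f differentiable (at y)" and d2: "?g r differentiable (at y)"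
    and c: "continuous_on N (\<lambda>y. frechet_derivative (?g r) (at y) v)" if "y \<in> N" for y r v
    using f that unfolding numeral_2_eq_2 by auto
  show "\<And>y. y \<in> N \<Longrightarrow> f differentiable (at y)" by (rule d)
  have D: "(partial_deriv r f has_derivative frechet_derivative (?g r) (at y)) (at y)" if "y \<in> N" for y r
    by (rule has_derivative_transform_within_open[OF d2[OF that, unfolded frechet_derivative_works] N that])
       (simp add: partial_deriv_eq_frechet_derivative d)
  then show pd: "partial_deriv r f differentiable (at y)" if "y \<in> N" for y r
    using that by (auto simp: differentiable_def)
  show "continuous_on N (partial_deriv s (partial_deriv r f))" for r s
  proof (cases "N = {}")
    case False
    then have "continuous_on N (\<lambda>y. frechet_derivative (?g r) (at y) (axis s 1))" using c by blast
    then show ?thesis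
    proof (rule continuous_on_eq)
      fix y assume y: "y \<in> N"
      show "frechet_derivative (?g r) (at y) (axis s 1) = partial_deriv s (partial_deriv r f) y"
        using frechet_derivative_at[OF D[OF y]] partial_deriv_eq_frechet_derivative[OF pd[OF y]] by simp
    qed
  qed simp
qed

text \<open>
  Taylor's formula of order two for \<open>t \<mapsto> f (y + t w)\<close>.
\<close>

lemma second_order_Taylor:
  fixes f :: "real^'d \<Rightarrow> real"
  assumes f: "Ck_on 2 f N" and N: "open N" and ball: "ball y R \<subseteq> N" and w: "norm w < R"
  shows "\<exists>t. 0 < t \<and> t < 1 \<and>
    f (y + w) = f y + gradient f y \<bullet> w + w \<bullet> (hessian f (y + t *\<^sub>R w) *v w) / 2"
proof -
  have inN: "y + t *\<^sub>R w \<in> N" if "0 \<le> t" "t \<le> 1" for t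
  proof -
    have "t * norm w \<le> 1 * norm w" using that by (intro mult_right_mono) auto
    then have "norm (t *\<^sub>R w) < R" using w that by simp
    then show ?thesis using ball by (auto simp: dist_norm)
  qed
  define diff where "diff m t = (if m = 0 then f (y + t *\<^sub>R w)
     else if m = 1 then (\<Sum>r\<in>UNIV. w $ r * partial_deriv r f (y + t *\<^sub>R w))
     else (\<Sum>r\<in>UNIV. w $ r * (\<Sum>s\<in>UNIV. w $ s * partial_deriv s (partial_deriv r f) (y + t *\<^sub>R w))))"
    for m :: nat and t
  have "\<exists>t>0. t < 1 \<and> diff 0 1 = (\<Sum>m<2. diff m 0 / fact m * 1 ^ m) + diff 2 t / fact 2 * 1 ^ 2"
  proof (rule Maclaurin)
    show "\<forall>m t. m < 2 \<and> 0 \<le> t \<and> t \<le> 1 \<longrightarrow> (diff m has_real_derivative diff (Suc m) t) (at t)"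
    proof (intro allI impI, elim conjE)
      fix m :: nat and t :: real assume "m < 2" and t: "0 \<le> t" "t \<le> 1"
      then consider "m = 0" | "m = 1" by linarith
      then show "(diff m has_real_derivative diff (Suc m) t) (at t)"
      proof cases
        case 1
        then show ?thesis
          using has_real_derivative_along_line_gradient[OF Ck_on_2_differentiable[OF f N inN[OF t]]]
          by (simp add: diff_def[abs_def])
      next
        case 2
        have "((\<lambda>t. \<Sum>r\<in>UNIV. w $ r * partial_deriv r f (y + t *\<^sub>R w)) has_real_derivative
            (\<Sum>r\<in>UNIV. w $ r * (\<Sum>s\<in>UNIV. w $ s * partial_deriv s (partial_deriv r f) (y + t *\<^sub>R w)))) (at t)"
          by (intro DERIV_sum DERIV_cmult has_real_derivative_along_line_gradient
               Ck_on_2_partial_deriv_differentiable[OF f N inN[OF t]])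
        then show ?thesis using 2 by (simp add: diff_def[abs_def])
      qed
    qed
  qed auto
  then obtain t where t: "0 < t" "t < 1" and
    eq: "diff 0 1 = (\<Sum>m<2. diff m 0 / fact m * 1 ^ m) + diff 2 t / fact 2 * 1 ^ 2"
    by blast
  have "f (y + w) = f y + gradient f y \<bullet> w + w \<bullet> (hessian f (y + t *\<^sub>R w) *v w) / 2"
    using eq by (simp add: diff_def numeral_2_eq_2 gradient_def hessian_def inner_vec_def
        matrix_vector_mult_def mult.commute)
  with t show ?thesis by blast
qed

text \<open>
  Applying the mean value theorem in direction \<open>r\<close> and then in direction \<open>s\<close> expresses the mixed
  second difference by \<open>D\<^sub>s D\<^sub>r f\<close> at a nearby point.  The left-hand side is symmetric in \<open>r\<close> and
  \<open>s\<close>, whence the symmetry of the Hessian in the next lemma.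
\<close>

lemma mixed_difference_eq:
  fixes f :: "real^'d \<Rightarrow> real"
  assumes f: "Ck_on 2 f N" and N: "open N" and ball: "ball y R \<subseteq> N" and h: "0 < h" "2 * h < R"
  shows "\<exists>z\<in>cball y (2 * h).
    f (y + h *\<^sub>R axis r 1 + h *\<^sub>R axis s 1) - f (y + h *\<^sub>R axis r 1) - f (y + h *\<^sub>R axis s 1) + f y
    = h\<^sup>2 * partial_deriv s (partial_deriv r f) z"
proof -
  let ?p = "\<lambda>a b. y + a *\<^sub>R axis r 1 + b *\<^sub>R axis s 1"
  have near: "?p a b \<in> cball y (2 * h)" if "0 \<le> a" "a \<le> h" "0 \<le> b" "b \<le> h" for a b
  proof -
    have "norm (a *\<^sub>R axis r 1 + b *\<^sub>R axis s 1 :: real^'d) \<le> a + b"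
      using that by (intro order_trans[OF norm_triangle_ineq]) simp
    then show ?thesis using that by (simp add: dist_norm norm_minus_commute algebra_simps)
  qed
  have sub: "cball y (2 * h) \<subseteq> N" using h ball by (intro order_trans[OF _ ball]) auto
  have inN: "?p a b \<in> N" if "0 \<le> a" "a \<le> h" "0 \<le> b" "b \<le> h" for a b
    using near[OF that] sub by blast
  have d1: "((\<lambda>a. f (?p a b)) has_real_derivative partial_deriv r f (?p a b)) (at a)"
    if "0 \<le> a" "a \<le> h" "0 \<le> b" "b \<le> h" for a b
    using has_real_derivative_along_axis[of f "y + b *\<^sub>R axis s 1" a r] Ck_on_2_differentiable[OF f N inN[OF that]]
    by (simp add: add.assoc add.commute[of "b *\<^sub>R _"])
  have "\<exists>a. 0 < a \<and> a < h \<and> (f (?p h h) - f (?p h 0)) - (f (?p 0 h) - f (?p 0 0))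
      = (h - 0) * (partial_deriv r f (?p a h) - partial_deriv r f (?p a 0))"
  proof (rule MVT2[of 0 h "\<lambda>a. f (?p a h) - f (?p a 0)"])
    show "0 < h" by (rule h)
    show "((\<lambda>a. f (?p a h) - f (?p a 0)) has_real_derivative
        partial_deriv r f (?p a h) - partial_deriv r f (?p a 0)) (at a)" if "0 \<le> a" "a \<le> h" for a
      by (intro DERIV_diff d1) (use h that in auto)
  qed
  then obtain a where a: "0 < a" "a < h" and
    1: "(f (?p h h) - f (?p h 0)) - (f (?p 0 h) - f (?p 0 0))
      = h * (partial_deriv r f (?p a h) - partial_deriv r f (?p a 0))" by auto
  have "\<exists>b. 0 < b \<and> b < h \<and> partial_deriv r f (?p a h) - partial_deriv r f (?p a 0)
      = (h - 0) * partial_deriv s (partial_deriv r f) (?p a b)"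
    by (rule MVT2) (use h a in \<open>auto intro!: has_real_derivative_along_axis
         Ck_on_2_partial_deriv_differentiable[OF f N inN]\<close>)
  then obtain b where b: "0 < b" "b < h" and
    2: "partial_deriv r f (?p a h) - partial_deriv r f (?p a 0) = h * partial_deriv s (partial_deriv r f) (?p a b)"
    by auto
  show ?thesis
    using 1 2 near[of a b] a b by (intro bexI[of _ "?p a b"]) (auto simp: power2_eq_square)
qed

lemma partial_deriv_commute:
  fixes f :: "real^'d \<Rightarrow> real"
  assumes f: "Ck_on 2 f N" and N: "open N" and y: "y \<in> N"
  shows "partial_deriv s (partial_deriv r f) y = partial_deriv r (partial_deriv s f) y" (is "?A y = ?B y")
proof (rule ccontr)
  assume ne: "?A y \<noteq> ?B y"
  define e where "e = \<bar>?A y - ?B y\<bar> / 2"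
  have e: "e > 0" using ne by (simp add: e_def)
  have "continuous (at y) ?A" "continuous (at y) ?B"
    using Ck_on_2_continuous_second[OF f N] N y by (simp_all add: continuous_on_eq_continuous_at)
  then have "\<exists>d>0. \<forall>z. dist z y < d \<longrightarrow> dist (?A z) (?A y) < e"
    and "\<exists>d>0. \<forall>z. dist z y < d \<longrightarrow> dist (?B z) (?B y) < e"
    using e unfolding continuous_at_eps_delta by blast+
  then obtain d1 d2 where d1: "d1 > 0" "\<And>z. dist z y < d1 \<Longrightarrow> dist (?A z) (?A y) < e"
    and d2: "d2 > 0" "\<And>z. dist z y < d2 \<Longrightarrow> dist (?B z) (?B y) < e"
    by blast
  obtain R where R: "R > 0" "ball y R \<subseteq> N" using N y by (auto simp: open_contains_ball)
  define h where "h = min R (min d1 d2) / 4"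
  have h: "0 < h" "2 * h < R" "2 * h < d1" "2 * h < d2"
    using R d1 d2 by (auto simp: h_def)
  obtain z where z: "z \<in> cball y (2 * h)" and
    z_eq: "f (y + h *\<^sub>R axis r 1 + h *\<^sub>R axis s 1) - f (y + h *\<^sub>R axis r 1) - f (y + h *\<^sub>R axis s 1) + f y
      = h\<^sup>2 * ?A z"
    using mixed_difference_eq[OF f N R(2) h(1,2), of r s] by blast
  obtain z' where z': "z' \<in> cball y (2 * h)" and
    z'_eq: "f (y + h *\<^sub>R axis s 1 + h *\<^sub>R axis r 1) - f (y + h *\<^sub>R axis s 1) - f (y + h *\<^sub>R axis r 1) + f y
      = h\<^sup>2 * ?B z'"
    using mixed_difference_eq[OF f N R(2) h(1,2), of s r] by blast
  have swap: "y + h *\<^sub>R axis s 1 + h *\<^sub>R axis r 1 = y + h *\<^sub>R axis r 1 + h *\<^sub>R axis s 1"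
    by (simp add: algebra_simps)
  have "h\<^sup>2 * ?A z = h\<^sup>2 * ?B z'"
    using z_eq z'_eq unfolding swap by linarith
  then have "?A z = ?B z'" using h by simp
  moreover have "\<bar>?A z - ?A y\<bar> < e" "\<bar>?B z' - ?B y\<bar> < e"
    using d1(2)[of z] d2(2)[of z'] z z' h by (auto simp: dist_real_def dist_commute)
  ultimately have "\<bar>?A y - ?B y\<bar> < 2 * e" by linarith
  then show False by (simp add: e_def)
qed

text \<open>
  If \<open>w \<bullet> (A w) = 0\<close>, moving from \<open>w\<close> a little in the direction \<open>- A w\<close> would make the quadratic
  form negative unless \<open>A w = 0\<close>; symmetry is what produces the factor two in front of the linear
  term.  The constant \<open>c\<close> is the minimum of the form on the unit sphere.
\<close>

lemma positive_definite_if_invertible: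
  fixes A :: "real^'d^'d"
  assumes sym: "transpose A = A" and psd: "\<And>w. 0 \<le> w \<bullet> (A *v w)" and inv: "invertible A"
  obtains c where "c > 0" "\<And>w. c * (norm w)\<^sup>2 \<le> w \<bullet> (A *v w)"
proof -
  have pos: "w \<bullet> (A *v w) > 0" if "w \<noteq> 0" for w
  proof (rule ccontr)
    assume "\<not> ?thesis"
    then have zero: "w \<bullet> (A *v w) = 0" using psd[of w] by linarith
    define z where "z = A *v w"
    define k where "k = z \<bullet> (A *v z)"
    have k: "k \<ge> 0" using psd[of z] by (simp add: k_def)
    have wz: "w \<bullet> (A *v z) = z \<bullet> z"
      using dot_lmul_matrix[of w A z] transpose_matrix_vector[of A w] sym by (simp add: z_def)
    \<comment> \<open>A step so short that the quadratic term \<open>t\<^sup>2 k\<close> cannot compensate the linear term.\<close>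
    define t where "t = - (z \<bullet> z) / (k + 1)"
    have "0 \<le> (w + t *\<^sub>R z) \<bullet> (A *v (w + t *\<^sub>R z))" by (rule psd)
    also have "\<dots> = 2 * t * (z \<bullet> z) + t\<^sup>2 * k"
      using zero wz
      by (simp add: matrix_vector_right_distrib matrix_vector_mult_scaleR inner_add_left inner_add_right
          k_def power2_eq_square flip: z_def) (simp add: z_def algebra_simps)
    finally have "0 \<le> t * (2 * (z \<bullet> z) + t * k)" by (simp add: power2_eq_square algebra_simps)
    moreover have "t * k \<ge> - (z \<bullet> z)"
      using k by (simp add: t_def field_simps mult_left_mono)
    moreover have "z \<noteq> 0"
    proof
      assume "z = 0"
      obtain B where "B ** A = mat 1" using inv by (auto simp: invertible_def)
      then have "w = B *v (A *v w)" by (simp add: matrix_vector_mul_assoc)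
      then show False using \<open>z = 0\<close> that by (simp add: z_def)
    qed
    then have "z \<bullet> z > 0" by simp
    moreover have "t < 0" using \<open>z \<bullet> z > 0\<close> k by (simp add: t_def field_simps)
    ultimately show False
      using mult_neg_pos[of t "2 * (z \<bullet> z) + t * k"] \<open>z \<bullet> z > 0\<close> by linarith
  qed
  have "compact (sphere (0::real^'d) 1)" by simp
  moreover have "sphere (0::real^'d) 1 \<noteq> {}" by simp
  moreover have "continuous_on (sphere (0::real^'d) 1) (\<lambda>w. w \<bullet> (A *v w))"
    by (intro continuous_intros linear_continuous_on matrix_vector_mul_bounded_linear)
  ultimately obtain u where u: "u \<in> sphere 0 1" "\<And>v. v \<in> sphere 0 1 \<Longrightarrow> u \<bullet> (A *v u) \<le> v \<bullet> (A *v v)"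
    using continuous_attains_inf by meson
  show ?thesis
  proof (rule that[of "u \<bullet> (A *v u)"])
    show "u \<bullet> (A *v u) > 0" using u(1) by (intro pos) auto
    fix w :: "real^'d"
    show "u \<bullet> (A *v u) * (norm w)\<^sup>2 \<le> w \<bullet> (A *v w)"
    proof (cases "w = 0")
      case False
      have "u \<bullet> (A *v u) \<le> (inverse (norm w) *\<^sub>R w) \<bullet> (A *v (inverse (norm w) *\<^sub>R w))"
        using False by (intro u(2)) auto
      also have "\<dots> = (w \<bullet> (A *v w)) / (norm w)\<^sup>2"
        by (simp add: matrix_vector_mult_scaleR field_simps power2_eq_square)
      finally show ?thesis using False by (simp add: pos_le_divide_eq)
    qed simp
  qed
qed

section \<open>Minima of sample means with a quadratic expansion\<close>

lemma linear_plus_quadratic_eq_sum: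
  "g \<bullet> w + w \<bullet> (A *v w) / 2 =
    (\<Sum>r\<in>UNIV. w $ r * g $ r) + (\<Sum>r\<in>UNIV. \<Sum>s\<in>UNIV. w $ r * w $ s / 2 * A $ r $ s)"
  for g w :: "real^'d"
  unfolding inner_matrix_vector_eq_sum by (simp add: inner_vec_def mult.commute sum_divide_distrib)

lemma sample_mean_quadratic:
  fixes G :: "'x \<Rightarrow> real^'d" and H :: "'x \<Rightarrow> real^'d^'d"
  shows "sample_mean x (\<lambda>x. G x \<bullet> w + w \<bullet> (H x *v w) / 2) n =
    (\<chi> r. sample_mean x (\<lambda>x. G x $ r) n) \<bullet> w + w \<bullet> ((\<chi> r s. sample_mean x (\<lambda>x. H x $ r $ s) n) *v w) / 2"
  unfolding linear_plus_quadratic_eq_sum sample_mean_add sample_mean_sum sample_mean_cmult by simp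

lemma integral_quadratic:
  fixes G :: "'x \<Rightarrow> real^'d" and H :: "'x \<Rightarrow> real^'d^'d"
  assumes G: "\<And>r. integrable Q (\<lambda>x. G x $ r)" and H: "\<And>r s. integrable Q (\<lambda>x. H x $ r $ s)"
  shows "integrable Q (\<lambda>x. G x \<bullet> w + w \<bullet> (H x *v w) / 2)"
    and "(\<integral>x. G x \<bullet> w + w \<bullet> (H x *v w) / 2 \<partial>Q) =
      (\<chi> r. \<integral>x. G x $ r \<partial>Q) \<bullet> w + w \<bullet> ((\<chi> r s. \<integral>x. H x $ r $ s \<partial>Q) *v w) / 2"
  unfolding linear_plus_quadratic_eq_sum using G H by (simp_all add: Bochner_Integration.integral_sum)

text \<open>
  The first and second order necessary conditions at a minimum.  Differentiation under the
  integral sign is avoided: the expansion in mean is integrated, and the inequality is tested at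
  \<open>t u\<close> for \<open>t\<close> tending to zero, once divided by \<open>t\<close> and once by \<open>t\<^sup>2\<close>.
\<close>

lemma minimum_expansion_conditions:
  fixes f :: "'x \<Rightarrow> real^'d \<Rightarrow> real" and G :: "'x \<Rightarrow> real^'d" and H :: "'x \<Rightarrow> real^'d^'d"
  assumes G: "\<And>r. integrable Q (\<lambda>x. G x $ r)" and H: "\<And>r s. integrable Q (\<lambda>x. H x $ r $ s)"
    and f: "\<And>w. integrable Q (\<lambda>x. f x w)"
    and min: "\<And>w. norm w < R \<Longrightarrow> (\<integral>x. f x 0 \<partial>Q) \<le> (\<integral>x. f x w \<partial>Q)" and R: "R > 0"
    and expansion: "\<And>\<eta>. \<eta> > 0 \<Longrightarrow> \<exists>\<epsilon>>0. \<exists>m. integrable Q m \<and> (\<integral>x. m x \<partial>Q) \<le> \<eta> \<and>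
      (AE x in Q. \<forall>w. norm w < \<epsilon> \<longrightarrow>
         \<bar>f x w - f x 0 - (G x \<bullet> w + w \<bullet> (H x *v w) / 2)\<bar> \<le> m x * (norm w)\<^sup>2)"
  shows "(\<chi> r. \<integral>x. G x $ r \<partial>Q) = 0"
    and "\<And>w. 0 \<le> w \<bullet> ((\<chi> r s. \<integral>x. H x $ r $ s \<partial>Q) *v w)"
proof -
  define g where "g = (\<chi> r. \<integral>x. G x $ r \<partial>Q)"
  define L where "L = (\<chi> r s. \<integral>x. H x $ r $ s \<partial>Q)"
  have key: "\<exists>\<epsilon>>0. \<forall>w. norm w < \<epsilon> \<longrightarrow> 0 \<le> g \<bullet> w + w \<bullet> (L *v w) / 2 + \<eta> * (norm w)\<^sup>2" if \<eta>: "\<eta> > 0" for \<eta>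
  proof -
    obtain \<epsilon> m where \<epsilon>: "\<epsilon> > 0" and m: "integrable Q m" "(\<integral>x. m x \<partial>Q) \<le> \<eta>"
      and e: "AE x in Q. \<forall>w. norm w < \<epsilon> \<longrightarrow>
         \<bar>f x w - f x 0 - (G x \<bullet> w + w \<bullet> (H x *v w) / 2)\<bar> \<le> m x * (norm w)\<^sup>2"
      using expansion[OF \<eta>] by blast
    have "0 \<le> g \<bullet> w + w \<bullet> (L *v w) / 2 + \<eta> * (norm w)\<^sup>2" if w: "norm w < min \<epsilon> R" for w
    proof -
      have "(\<integral>x. f x w - f x 0 \<partial>Q) \<le> (\<integral>x. (G x \<bullet> w + w \<bullet> (H x *v w) / 2) + m x * (norm w)\<^sup>2 \<partial>Q)"
      proof (rule integral_mono_AE)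
        show "integrable Q (\<lambda>x. (G x \<bullet> w + w \<bullet> (H x *v w) / 2) + m x * (norm w)\<^sup>2)"
          by (intro Bochner_Integration.integrable_add integral_quadratic(1) G H integrable_mult_left m)
        show "AE x in Q. f x w - f x 0 \<le> (G x \<bullet> w + w \<bullet> (H x *v w) / 2) + m x * (norm w)\<^sup>2"
          using e
        proof (rule eventually_mono)
          fix x assume "\<forall>w. norm w < \<epsilon> \<longrightarrow>
            \<bar>f x w - f x 0 - (G x \<bullet> w + w \<bullet> (H x *v w) / 2)\<bar> \<le> m x * (norm w)\<^sup>2"
          with w have "\<bar>f x w - f x 0 - (G x \<bullet> w + w \<bullet> (H x *v w) / 2)\<bar> \<le> m x * (norm w)\<^sup>2" by simp
          then show "f x w - f x 0 \<le> (G x \<bullet> w + w \<bullet> (H x *v w) / 2) + m x * (norm w)\<^sup>2" by linarith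
        qed
      qed (use f in simp)
      also have "\<dots> = (g \<bullet> w + w \<bullet> (L *v w) / 2) + (\<integral>x. m x \<partial>Q) * (norm w)\<^sup>2"
        unfolding g_def L_def integral_quadratic(2)[OF G H, symmetric]
        by (subst Bochner_Integration.integral_add) (use integral_quadratic(1)[OF G H] m in auto)
      also have "\<dots> \<le> (g \<bullet> w + w \<bullet> (L *v w) / 2) + \<eta> * (norm w)\<^sup>2"
        using m(2) by (intro add_left_mono mult_right_mono) auto
      finally show ?thesis using min[of w] w f by simp
    qed
    then show ?thesis using \<epsilon> R by (intro exI[of _ "min \<epsilon> R"]) auto
  qed
  have psd_scaled: "\<exists>\<epsilon>>0. \<forall>t. 0 < t \<and> t < \<epsilon> \<longrightarrow> 0 \<le> g \<bullet> u + t * (u \<bullet> (L *v u) / 2 + \<eta> * (norm u)\<^sup>2)"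
    if \<eta>: "\<eta> > 0" for u \<eta>
  proof -
    obtain \<epsilon> where \<epsilon>: "\<epsilon> > 0"
      and *: "\<And>w. norm w < \<epsilon> \<Longrightarrow> 0 \<le> g \<bullet> w + w \<bullet> (L *v w) / 2 + \<eta> * (norm w)\<^sup>2"
      using key[OF \<eta>] by blast
    have "0 \<le> g \<bullet> u + t * (u \<bullet> (L *v u) / 2 + \<eta> * (norm u)\<^sup>2)" if t: "0 < t" "t < \<epsilon> / (norm u + 1)" for t
    proof -
      have "t * norm u \<le> t * (norm u + 1)" using t by (intro mult_left_mono) auto
      also have "\<dots> < \<epsilon>" using t by (simp add: pos_less_divide_eq add_nonneg_pos)
      finally have "norm (t *\<^sub>R u) < \<epsilon>" using t by simp
      from *[OF this] have "0 \<le> t * (g \<bullet> u + t * (u \<bullet> (L *v u) / 2 + \<eta> * (norm u)\<^sup>2))"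
        by (simp add: matrix_vector_mult_scaleR power_mult_distrib algebra_simps power2_eq_square)
      then show ?thesis using t by (simp add: zero_le_mult_iff)
    qed
    then show ?thesis using \<epsilon> by (intro exI[of _ "\<epsilon> / (norm u + 1)"]) (auto simp: add_nonneg_pos)
  qed
  have lin: "0 \<le> g \<bullet> u" for u
  proof -
    let ?k = "u \<bullet> (L *v u) / 2 + 1 * (norm u)\<^sup>2"
    obtain \<epsilon> where \<epsilon>: "\<epsilon> > 0" and *: "\<And>t. 0 < t \<Longrightarrow> t < \<epsilon> \<Longrightarrow> 0 \<le> g \<bullet> u + t * ?k"
      using psd_scaled[of 1 u] by auto
    have "((\<lambda>t. g \<bullet> u + t * ?k) \<longlongrightarrow> g \<bullet> u + 0 * ?k) (at_right 0)"
      by (intro tendsto_intros)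
    moreover have "\<forall>\<^sub>F t in at_right 0. 0 \<le> g \<bullet> u + t * ?k"
      using \<epsilon> * by (intro eventually_at_rightI[of 0 \<epsilon>]) auto
    ultimately have "0 \<le> g \<bullet> u + 0 * ?k"
      by (intro tendsto_lowerbound[OF _ _ trivial_limit_at_right_real])
    then show ?thesis by simp
  qed
  have "g \<bullet> g \<le> 0" using lin[of "- g"] by simp
  then have g0: "g = 0" by (metis antisym inner_eq_zero_iff inner_ge_zero)
  then show "(\<chi> r. \<integral>x. G x $ r \<partial>Q) = 0" by (simp add: g_def)
  show "0 \<le> w \<bullet> ((\<chi> r s. \<integral>x. H x $ r $ s \<partial>Q) *v w)" for w
  proof -
    have "0 \<le> w \<bullet> (L *v w) / 2 + \<eta>" if "\<eta> > 0" for \<eta>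
    proof -
      let ?\<eta> = "\<eta> / ((norm w)\<^sup>2 + 1)"
      have pos: "(norm w)\<^sup>2 + 1 > 0" by (simp add: add_nonneg_pos)
      have "?\<eta> > 0" using that pos by simp
      then obtain \<epsilon> where \<epsilon>: "\<epsilon> > 0" and
        *: "\<And>t. 0 < t \<Longrightarrow> t < \<epsilon> \<Longrightarrow> 0 \<le> g \<bullet> w + t * (w \<bullet> (L *v w) / 2 + ?\<eta> * (norm w)\<^sup>2)"
        using psd_scaled[of ?\<eta> w] by blast
      have "0 \<le> w \<bullet> (L *v w) / 2 + ?\<eta> * (norm w)\<^sup>2"
        using *[of "\<epsilon> / 2"] \<epsilon> g0 by (simp add: zero_le_mult_iff)
      also have "?\<eta> * (norm w)\<^sup>2 \<le> \<eta>"
        using that pos by (simp add: divide_simps)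
      finally show ?thesis by simp
    qed
    then have "0 \<le> w \<bullet> (L *v w) / 2" by (rule field_le_epsilon)
    then show ?thesis by (simp add: L_def)
  qed
qed

text \<open>
  Completing the square.
\<close>

lemma quadratic_minus_linear_ge:
  fixes g w :: "'a::real_inner"
  assumes "c > 0"
  shows "- ((norm g)\<^sup>2 / (4 * c)) \<le> g \<bullet> w + c * (norm w)\<^sup>2"
proof -
  have "0 \<le> (2 * c * norm w - norm g)\<^sup>2" by simp
  then have "norm g * norm w \<le> c * (norm w)\<^sup>2 + (norm g)\<^sup>2 / (4 * c)"
    using assms by (simp add: power2_eq_square field_simps)
  moreover have "\<bar>g \<bullet> w\<bar> \<le> norm g * norm w" by (rule Cauchy_Schwarz_ineq2)
  ultimately show ?thesis by linarith
qed

text \<open>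
  The sample mean of \<open>f\<close> at \<open>0\<close> exceeds its infimum over a small ball by at most a multiple of the
  squared norm of the sample mean \<open>g\<close> of the gradients: the expansion and positive definiteness
  leave \<open>g \<bullet> w + (c / 8) |w|\<^sup>2\<close> as a lower bound for the increment.  Of the constant \<open>c / 2\<close>
  coming from the Hessian, \<open>c / 8\<close> is spent on its estimation and \<open>c / 4\<close> on the error of the
  expansion.
\<close>

lemma (in iid_sample) sample_minimum_excess_whp:
  fixes f :: "'x \<Rightarrow> real^'d \<Rightarrow> real" and G :: "'x \<Rightarrow> real^'d" and H :: "'x \<Rightarrow> real^'d^'d"
  assumes G_meas: "\<And>r. (\<lambda>x. G x $ r) \<in> borel_measurable borel"
    and G2: "\<And>r. integrable Q (\<lambda>x. (G x $ r)\<^sup>2)" and H: "\<And>r s. integrable Q (\<lambda>x. H x $ r $ s)"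
    and f: "\<And>w. integrable Q (\<lambda>x. f x w)"
    and min: "\<And>w. norm w < R \<Longrightarrow> (\<integral>x. f x 0 \<partial>Q) \<le> (\<integral>x. f x w \<partial>Q)" and R: "R > 0"
    and expansion: "\<And>\<eta>. \<eta> > 0 \<Longrightarrow> \<exists>\<epsilon>>0. \<exists>m. integrable Q m \<and> (\<integral>x. m x \<partial>Q) \<le> \<eta> \<and>
      (AE x in Q. \<forall>w. norm w < \<epsilon> \<longrightarrow>
         \<bar>f x w - f x 0 - (G x \<bullet> w + w \<bullet> (H x *v w) / 2)\<bar> \<le> m x * (norm w)\<^sup>2)"
    and sym: "transpose (\<chi> r s. \<integral>x. H x $ r $ s \<partial>Q) = (\<chi> r s. \<integral>x. H x $ r $ s \<partial>Q)"
    and inv: "invertible (\<chi> r s. \<integral>x. H x $ r $ s \<partial>Q)"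
  obtains \<epsilon> where "\<epsilon> > 0" "\<And>e. e > 0 \<Longrightarrow> whp (\<lambda>n \<omega>. \<forall>w. norm w < \<epsilon> \<longrightarrow>
      sqrt (real n) * (sample_mean (\<lambda>j. X j \<omega>) (\<lambda>x. f x 0) n - sample_mean (\<lambda>j. X j \<omega>) (\<lambda>x. f x w) n) < e)"
proof -
  interpret Q: prob_space Q by (rule prob_space_Q)
  define L where "L = (\<chi> r s. \<integral>x. H x $ r $ s \<partial>Q)"
  have G: "integrable Q (\<lambda>x. G x $ r)" for r
    by (rule Q.square_integrable_imp_integrable[OF _ G2]) (use G_meas measurable_cong_sets[OF sets_Q refl] in blast)
  note min_conds = minimum_expansion_conditions[OF G H f min R expansion]
  have G0: "(\<integral>x. G x $ r \<partial>Q) = 0" for r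
    using arg_cong[OF min_conds(1), of "\<lambda>v. v $ r"] by simp
  obtain c where c: "c > 0" "\<And>w. c * (norm w)\<^sup>2 \<le> w \<bullet> (L *v w)"
    using positive_definite_if_invertible[OF sym min_conds(2) inv] unfolding L_def by metis
  obtain \<epsilon> m where \<epsilon>: "\<epsilon> > 0" and m: "integrable Q m" "(\<integral>x. m x \<partial>Q) \<le> c / 8"
    and e: "AE x in Q. \<forall>w. norm w < \<epsilon> \<longrightarrow>
         \<bar>f x w - f x 0 - (G x \<bullet> w + w \<bullet> (H x *v w) / 2)\<bar> \<le> m x * (norm w)\<^sup>2"
    using expansion[of "c / 8"] c by auto
  let ?d = "real CARD('d)"
  show thesis
  proof (rule that[OF \<epsilon>])
    fix \<delta> :: real assume \<delta>: "\<delta> > 0"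
    let ?m = "\<lambda>f n \<omega>. sample_mean (\<lambda>j. X j \<omega>) f n"
    have "whp (\<lambda>n \<omega>. (\<forall>j. \<forall>w. norm w < \<epsilon> \<longrightarrow>
         \<bar>f (X j \<omega>) w - f (X j \<omega>) 0 - (G (X j \<omega>) \<bullet> w + w \<bullet> (H (X j \<omega>) *v w) / 2)\<bar> \<le> m (X j \<omega>) * (norm w)\<^sup>2))"
      by (intro whp_AE AE_X e)
    moreover have "whp (\<lambda>n \<omega>. \<bar>?m m n \<omega> - (\<integral>x. m x \<partial>Q)\<bar> < c / 8)"
      using c by (intro weak_law m) auto
    moreover have "whp (\<lambda>n \<omega>. \<forall>r\<in>UNIV. \<forall>s\<in>UNIV. \<bar>?m (\<lambda>x. H x $ r $ s) n \<omega> - (\<integral>x. H x $ r $ s \<partial>Q)\<bar> < c / (4 * ?d\<^sup>2))"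
      using c by (intro whp_ball_finite weak_law H) auto
    moreover have "whp (\<lambda>n \<omega>. \<forall>r\<in>UNIV. sqrt (real n) * (?m (\<lambda>x. G x $ r) n \<omega>)\<^sup>2 < \<delta> * c / (2 * ?d))"
      using c \<delta> by (intro whp_ball_finite sample_mean_square_rate G_meas G2 G0) auto
    ultimately have "whp (\<lambda>n \<omega>. (\<forall>j. \<forall>w. norm w < \<epsilon> \<longrightarrow>
         \<bar>f (X j \<omega>) w - f (X j \<omega>) 0 - (G (X j \<omega>) \<bullet> w + w \<bullet> (H (X j \<omega>) *v w) / 2)\<bar> \<le> m (X j \<omega>) * (norm w)\<^sup>2)
       \<and> \<bar>?m m n \<omega> - (\<integral>x. m x \<partial>Q)\<bar> < c / 8
       \<and> (\<forall>r\<in>UNIV. \<forall>s\<in>UNIV. \<bar>?m (\<lambda>x. H x $ r $ s) n \<omega> - (\<integral>x. H x $ r $ s \<partial>Q)\<bar> < c / (4 * ?d\<^sup>2))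
       \<and> (\<forall>r\<in>UNIV. sqrt (real n) * (?m (\<lambda>x. G x $ r) n \<omega>)\<^sup>2 < \<delta> * c / (2 * ?d)))"
      using whp_conj by force
    then show "whp (\<lambda>n \<omega>. \<forall>w. norm w < \<epsilon> \<longrightarrow>
      sqrt (real n) * (?m (\<lambda>x. f x 0) n \<omega> - ?m (\<lambda>x. f x w) n \<omega>) < \<delta>)"
    proof (rule whp_mono, intro allI impI, elim conjE)
      fix n \<omega> and w :: "real^'d"
      assume w: "norm w < \<epsilon>"
        and ex: "\<forall>j. \<forall>w. norm w < \<epsilon> \<longrightarrow>
         \<bar>f (X j \<omega>) w - f (X j \<omega>) 0 - (G (X j \<omega>) \<bullet> w + w \<bullet> (H (X j \<omega>) *v w) / 2)\<bar> \<le> m (X j \<omega>) * (norm w)\<^sup>2"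
        and mm: "\<bar>?m m n \<omega> - (\<integral>x. m x \<partial>Q)\<bar> < c / 8"
        and HH: "\<forall>r\<in>UNIV. \<forall>s\<in>UNIV. \<bar>?m (\<lambda>x. H x $ r $ s) n \<omega> - (\<integral>x. H x $ r $ s \<partial>Q)\<bar> < c / (4 * ?d\<^sup>2)"
        and GG: "\<forall>r\<in>UNIV. sqrt (real n) * (?m (\<lambda>x. G x $ r) n \<omega>)\<^sup>2 < \<delta> * c / (2 * ?d)"
      define g where "g = (\<chi> r. ?m (\<lambda>x. G x $ r) n \<omega>)"
      define K where "K = (\<chi> r s. ?m (\<lambda>x. H x $ r $ s) n \<omega>)"
      have "?m (\<lambda>x. f x 0 + (G x \<bullet> w + w \<bullet> (H x *v w) / 2)) n \<omega> \<le> ?m (\<lambda>x. f x w + (norm w)\<^sup>2 * m x) n \<omega>"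
      proof (rule sample_mean_mono)
        fix j
        have "\<bar>f (X j \<omega>) w - f (X j \<omega>) 0 - (G (X j \<omega>) \<bullet> w + w \<bullet> (H (X j \<omega>) *v w) / 2)\<bar> \<le> m (X j \<omega>) * (norm w)\<^sup>2"
          using ex w by blast
        then show "f (X j \<omega>) 0 + (G (X j \<omega>) \<bullet> w + w \<bullet> (H (X j \<omega>) *v w) / 2) \<le> f (X j \<omega>) w + (norm w)\<^sup>2 * m (X j \<omega>)"
          unfolding mult.commute[of "(norm w)\<^sup>2"] by linarith
      qed
      then have 1: "?m (\<lambda>x. f x 0) n \<omega> + (g \<bullet> w + w \<bullet> (K *v w) / 2) \<le> ?m (\<lambda>x. f x w) n \<omega> + (norm w)\<^sup>2 * ?m m n \<omega>"
        unfolding sample_mean_add sample_mean_cmult g_def K_def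
        by (simp only: sample_mean_quadratic[symmetric] sample_mean_add[symmetric])
      have "(\<Sum>r\<in>UNIV. \<Sum>s\<in>UNIV. \<bar>(K - L) $ r $ s\<bar>) \<le> (\<Sum>r\<in>(UNIV::'d set). \<Sum>s\<in>(UNIV::'d set). c / (4 * ?d\<^sup>2))"
        using HH by (intro sum_mono) (auto simp: K_def L_def intro: less_imp_le)
      also have "\<dots> = c / 4" by (simp add: power2_eq_square)
      finally have 2: "\<bar>w \<bullet> ((K - L) *v w)\<bar> \<le> c / 4 * (norm w)\<^sup>2"
        using abs_inner_matrix_vector_le[of w "K - L"] by (meson mult_right_mono order_trans zero_le_power2)
      have 3: "w \<bullet> ((K - L) *v w) = w \<bullet> (K *v w) - w \<bullet> (L *v w)"
        by (simp add: matrix_vector_mult_diff_rdistrib inner_diff_right)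
      have 4: "(norm w)\<^sup>2 * ?m m n \<omega> \<le> (norm w)\<^sup>2 * (c / 4)"
        using mm m(2) by (intro mult_left_mono zero_le_power2) linarith
      have 5: "- ((norm g)\<^sup>2 / (4 * (c / 8))) \<le> g \<bullet> w + c / 8 * (norm w)\<^sup>2"
        by (rule quadratic_minus_linear_ge) (use c in simp)
      define T where "T = c * (norm w)\<^sup>2"
      have "\<bar>w \<bullet> (K *v w) - w \<bullet> (L *v w)\<bar> \<le> T / 4" "(norm w)\<^sup>2 * ?m m n \<omega> \<le> T / 4"
        "- ((norm g)\<^sup>2 / (4 * (c / 8))) \<le> g \<bullet> w + T / 8" "T \<le> w \<bullet> (L *v w)"
        using 2 3 4 5 c(2)[of w] by (simp_all add: T_def mult.commute)
      then have "?m (\<lambda>x. f x 0) n \<omega> - ?m (\<lambda>x. f x w) n \<omega> \<le> (norm g)\<^sup>2 / (4 * (c / 8))"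
        using 1 by linarith
      then have "sqrt (real n) * (?m (\<lambda>x. f x 0) n \<omega> - ?m (\<lambda>x. f x w) n \<omega>)
          \<le> sqrt (real n) * ((norm g)\<^sup>2 / (4 * (c / 8)))"
        by (intro mult_left_mono) auto
      also have "\<dots> = (2 / c) * (\<Sum>r\<in>UNIV. sqrt (real n) * (g $ r)\<^sup>2)"
        unfolding power2_norm_eq_inner sum_distrib_left[symmetric]
        by (simp add: inner_vec_def power2_eq_square)
      also have "\<dots> < (2 / c) * (\<Sum>r\<in>(UNIV::'d set). \<delta> * c / (2 * ?d))"
        using c GG by (intro mult_strict_left_mono sum_strict_mono) (auto simp: g_def)
      also have "\<dots> = \<delta>" using c by simp
      finally show "sqrt (real n) * (?m (\<lambda>x. f x 0) n \<omega> - ?m (\<lambda>x. f x w) n \<omega>) < \<delta>" .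
    qed
  qed
qed

section \<open>Quadratic expansions that hold in mean\<close>

text \<open>
  A partial derivative is the limit of a sequence of difference quotients; as \<open>N\<close> is open, all
  points that occur in them can be taken in \<open>N\<close>, so that the lemma can be iterated.
\<close>

lemma borel_measurable_partial_deriv:
  fixes k :: "'x \<Rightarrow> real^'d \<Rightarrow> real"
  assumes meas: "\<And>y. y \<in> N \<Longrightarrow> (\<lambda>x. k x y) \<in> borel_measurable M" and N: "open N" "y \<in> N"
    and diff: "\<And>x. x \<in> space M \<Longrightarrow> k x differentiable (at y)"
  shows "(\<lambda>x. partial_deriv r (k x) y) \<in> borel_measurable M"
proof -
  obtain R where R: "R > 0" "ball y R \<subseteq> N" using N by (auto simp: open_contains_ball)
  define h where "h i = R / real (i + 2)" for i
  have h: "h i > 0" "h i < R" for i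
    using R by (simp_all add: h_def pos_divide_less_eq add_pos_nonneg)
  have h0: "h \<longlonglongrightarrow> 0"
    unfolding h_def by (rule LIMSEQ_ignore_initial_segment[OF lim_const_over_n])
  show ?thesis
  proof (rule borel_measurable_LIMSEQ_real)
    show "(\<lambda>x. (k x (y + h i *\<^sub>R axis r 1) - k x y) / h i) \<in> borel_measurable M" for i
    proof -
      have "y + h i *\<^sub>R axis r 1 \<in> N"
        using R(2) h[of i] by (intro subsetD[OF R(2)]) (simp add: dist_norm)
      then show ?thesis
        by (intro borel_measurable_divide borel_measurable_diff meas N borel_measurable_const)
    qed
    fix x assume x: "x \<in> space M"
    have "((\<lambda>t. k x (y + t *\<^sub>R axis r 1)) has_real_derivative partial_deriv r (k x) y) (at 0)"
      using has_real_derivative_along_axis[of "k x" y 0 r] diff[OF x] by simp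
    then have "((\<lambda>t. (k x (y + t *\<^sub>R axis r 1) - k x y) / t) \<longlongrightarrow> partial_deriv r (k x) y) (at 0)"
      by (simp add: DERIV_def)
    moreover have "filterlim h (at 0) sequentially"
      unfolding filterlim_at using h0 h(1) by (auto simp: less_imp_neq[symmetric] order.strict_iff_not)
    ultimately show "(\<lambda>i. (k x (y + h i *\<^sub>R axis r 1) - k x y) / h i) \<longlonglongrightarrow> partial_deriv r (k x) y"
      by (rule filterlim_compose)
  qed
qed

lemma le_on_open_if_le_on_dense:
  fixes g :: "'a::topological_space \<Rightarrow> real"
  assumes D: "\<And>S. open S \<Longrightarrow> S \<noteq> {} \<Longrightarrow> \<exists>d\<in>D. d \<in> S"
    and S: "open S" and g: "continuous_on S g" and le: "\<And>v. v \<in> D \<inter> S \<Longrightarrow> g v \<le> b" and v: "v \<in> S"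
  shows "g v \<le> b"
proof (rule ccontr)
  assume "\<not> g v \<le> b"
  then have "S \<inter> g -` {b<..} \<noteq> {}" using v by auto
  moreover have "open (S \<inter> g -` {b<..})" by (rule continuous_open_preimage[OF g S]) simp
  ultimately obtain d where "d \<in> D" "d \<in> S \<inter> g -` {b<..}" using D by blast
  then show False using le[of d] by auto
qed

text \<open>
  The error of the second order Taylor polynomial is at most the oscillation of the Hessian near
  \<open>y\<close> times \<open>|w|\<^sup>2\<close>.  The oscillation is taken over a countable dense set, which makes it a
  measurable function of \<open>x\<close>; by continuity of the second derivatives it bounds the oscillation
  over the whole ball.
\<close>

lemma Taylor_expansion_in_mean:
  fixes k :: "'x \<Rightarrow> real^'d \<Rightarrow> real"
  assumes k: "\<And>x. Ck_on 2 (k x) N" and N: "open N" "y \<in> N"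
    and meas: "\<And>v. v \<in> N \<Longrightarrow> (\<lambda>x. k x v) \<in> borel_measurable Q"
    and D: "countable D" "\<And>S. open S \<Longrightarrow> S \<noteq> {} \<Longrightarrow> \<exists>d\<in>D. d \<in> S"
    and osc_lim: "\<And>r s. ((\<lambda>\<epsilon>. \<integral>\<^sup>+ x. (SUP v\<in>D \<inter> N \<inter> ball y \<epsilon>.
        ennreal \<bar>partial_deriv s (partial_deriv r (k x)) v - partial_deriv s (partial_deriv r (k x)) y\<bar>) \<partial>Q)
        \<longlongrightarrow> 0) (at_right 0)"
    and \<eta>: "\<eta> > 0"
  shows "\<exists>\<epsilon>>0. \<exists>m. integrable Q m \<and> (\<integral>x. m x \<partial>Q) \<le> \<eta> \<and>
      (AE x in Q. \<forall>w. norm w < \<epsilon> \<longrightarrow>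
         \<bar>k x (y + w) - k x (y + 0) - (gradient (k x) y \<bullet> w + w \<bullet> (hessian (k x) y *v w) / 2)\<bar>
           \<le> m x * (norm w)\<^sup>2)"
proof -
  let ?d = "real CARD('d)"
  let ?D2 = "\<lambda>r s x. partial_deriv s (partial_deriv r (k x))"
  obtain R where R: "R > 0" "ball y R \<subseteq> N" using N by (auto simp: open_contains_ball)
  define osc where "osc r s \<epsilon> x = (SUP v\<in>D \<inter> N \<inter> ball y \<epsilon>. ennreal \<bar>?D2 r s x v - ?D2 r s x y\<bar>)" for r s \<epsilon> x
  \<comment> \<open>The error \<open>\<eta>\<close> is shared equally among the entries of the Hessian.\<close>
  define b where "b = \<eta> / ?d\<^sup>2"
  have b: "b > 0" using \<eta> by (simp add: b_def)
  have D2_meas: "(\<lambda>x. ?D2 r s x v) \<in> borel_measurable Q" if "v \<in> N" for r s v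
    using borel_measurable_partial_deriv[of N "\<lambda>x. partial_deriv r (k x)", OF _ N(1) that]
      borel_measurable_partial_deriv[of N k, OF meas N(1)]
      Ck_on_2_differentiable[OF k N(1)] Ck_on_2_partial_deriv_differentiable[OF k N(1)] that
    by blast
  have osc_meas: "osc r s \<epsilon> \<in> borel_measurable Q" for r s \<epsilon>
    unfolding osc_def
    by (intro borel_measurable_SUP measurable_compose[OF _ measurable_ennreal] borel_measurable_abs
          borel_measurable_diff D2_meas N countable_Int1 D) auto
  have "\<forall>\<^sub>F \<epsilon> in at_right 0. (\<integral>\<^sup>+ x. osc r s \<epsilon> x \<partial>Q) < ennreal b" for r s
    using osc_lim[of s r] unfolding osc_def by (rule order_tendstoD(2)) (use b in simp)
  then have "\<forall>\<^sub>F \<epsilon> in at_right 0. \<forall>r s. (\<integral>\<^sup>+ x. osc r s \<epsilon> x \<partial>Q) < ennreal b"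
    by (intro eventually_all_finite)
  moreover have "\<forall>\<^sub>F \<epsilon> in at_right 0. 0 < \<epsilon> \<and> \<epsilon> < R"
    using R by (intro eventually_at_rightI[of 0 R]) auto
  ultimately have "\<forall>\<^sub>F \<epsilon> in at_right 0. (\<forall>r s. (\<integral>\<^sup>+ x. osc r s \<epsilon> x \<partial>Q) < ennreal b) \<and> 0 < \<epsilon> \<and> \<epsilon> < R"
    by (rule eventually_conj)
  then obtain \<epsilon> where \<epsilon>: "0 < \<epsilon>" "\<epsilon> < R" and small: "\<And>r s. (\<integral>\<^sup>+ x. osc r s \<epsilon> x \<partial>Q) < ennreal b"
    using eventually_happens'[OF trivial_limit_at_right_real] by blast
  have ball: "ball y \<epsilon> \<subseteq> N" using R \<epsilon> by (intro order_trans[OF subset_ball R(2)]) auto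
  have fin: "AE x in Q. osc r s \<epsilon> x < \<infinity>" for r s
    using nn_integral_PInf_AE[OF osc_meas, of r s \<epsilon>] order.strict_trans[OF small ennreal_less_top, of r s]
    by (auto simp: less_top)
  have mint: "integrable Q (\<lambda>x. enn2real (osc r s \<epsilon> x))" and mle: "(\<integral>x. enn2real (osc r s \<epsilon> x) \<partial>Q) \<le> b" for r s
  proof -
    have eq: "(\<integral>\<^sup>+ x. ennreal (enn2real (osc r s \<epsilon> x)) \<partial>Q) = (\<integral>\<^sup>+ x. osc r s \<epsilon> x \<partial>Q)"
      by (rule nn_integral_cong_AE) (use fin[of r s] in \<open>auto simp: less_top\<close>)
    show int: "integrable Q (\<lambda>x. enn2real (osc r s \<epsilon> x))"
      using osc_meas[of r s \<epsilon>] eq small[of r s]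
      by (intro integrableI_nonneg) (auto simp: less_top[symmetric] intro: order.strict_trans)
    have "ennreal (\<integral>x. enn2real (osc r s \<epsilon> x) \<partial>Q) = (\<integral>\<^sup>+ x. osc r s \<epsilon> x \<partial>Q)"
      using nn_integral_eq_integral[OF int] eq by simp
    then show "(\<integral>x. enn2real (osc r s \<epsilon> x) \<partial>Q) \<le> b"
      using small[of r s] b by (metis ennreal_less_iff integral_nonneg_AE AE_I2 enn2real_nonneg less_imp_le)
  qed
  define m where "m x = (\<Sum>r\<in>UNIV. \<Sum>s\<in>UNIV. enn2real (osc r s \<epsilon> x))" for x
  have m_int: "integrable Q m" unfolding m_def using mint by auto
  have "(\<integral>x. m x \<partial>Q) \<le> (\<Sum>r\<in>(UNIV::'d set). \<Sum>s\<in>(UNIV::'d set). b)"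
    unfolding m_def using mint mle by (simp add: Bochner_Integration.integral_sum sum_mono del: sum_constant)
  also have "\<dots> = \<eta>" by (simp add: b_def power2_eq_square)
  finally have m_le: "(\<integral>x. m x \<partial>Q) \<le> \<eta>" .
  have "AE x in Q. \<forall>r s. osc r s \<epsilon> x < \<infinity>"
    using fin by (simp add: AE_all_countable)
  then have "AE x in Q. \<forall>w. norm w < \<epsilon> \<longrightarrow>
         \<bar>k x (y + w) - k x (y + 0) - (gradient (k x) y \<bullet> w + w \<bullet> (hessian (k x) y *v w) / 2)\<bar>
           \<le> m x * (norm w)\<^sup>2"
  proof (rule eventually_mono, intro allI impI)
    fix x and w :: "real^'d" assume fin: "\<forall>r s. osc r s \<epsilon> x < \<infinity>" and w: "norm w < \<epsilon>"
    obtain t where t: "0 < t" "t < 1" and eq: "k x (y + w) = k x y + gradient (k x) y \<bullet> w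
        + w \<bullet> (hessian (k x) (y + t *\<^sub>R w) *v w) / 2"
      using second_order_Taylor[OF k N(1) ball w] by blast
    let ?v = "y + t *\<^sub>R w"
    have "norm (t *\<^sub>R w) \<le> 1 * norm w" using t by (simp add: mult_left_le_one_le)
    then have v: "?v \<in> ball y \<epsilon>" using w by (simp add: dist_norm)
    have entry: "\<bar>?D2 r s x ?v - ?D2 r s x y\<bar> \<le> enn2real (osc r s \<epsilon> x)" for r s
    proof (rule le_on_open_if_le_on_dense[OF D(2), where S="ball y \<epsilon>" and g="\<lambda>v. \<bar>?D2 r s x v - ?D2 r s x y\<bar>"])
      show "continuous_on (ball y \<epsilon>) (\<lambda>v. \<bar>?D2 r s x v - ?D2 r s x y\<bar>)"
        by (intro continuous_intros continuous_on_subset[OF Ck_on_2_continuous_second[OF k N(1)] ball])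
      fix v assume "v \<in> D \<inter> ball y \<epsilon>"
      then have "ennreal \<bar>?D2 r s x v - ?D2 r s x y\<bar> \<le> osc r s \<epsilon> x"
        unfolding osc_def using ball by (intro SUP_upper) auto
      then show "\<bar>?D2 r s x v - ?D2 r s x y\<bar> \<le> enn2real (osc r s \<epsilon> x)"
        using fin by (metis abs_ge_zero enn2real_ennreal enn2real_mono infinity_ennreal_def)
    qed (use v in auto)
    have "\<bar>w \<bullet> ((hessian (k x) ?v - hessian (k x) y) *v w)\<bar>
        \<le> (\<Sum>r\<in>UNIV. \<Sum>s\<in>UNIV. \<bar>(hessian (k x) ?v - hessian (k x) y) $ r $ s\<bar>) * (norm w)\<^sup>2"
      by (rule abs_inner_matrix_vector_le)
    also have "\<dots> \<le> m x * (norm w)\<^sup>2"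
      unfolding m_def using entry by (intro mult_right_mono sum_mono) (auto simp: hessian_def)
    finally have "\<bar>w \<bullet> (hessian (k x) ?v *v w) - w \<bullet> (hessian (k x) y *v w)\<bar> \<le> m x * (norm w)\<^sup>2"
      by (simp add: matrix_vector_mult_diff_rdistrib inner_diff_right)
    then show "\<bar>k x (y + w) - k x (y + 0) - (gradient (k x) y \<bullet> w + w \<bullet> (hessian (k x) y *v w) / 2)\<bar>
           \<le> m x * (norm w)\<^sup>2"
      unfolding eq by simp
  qed
  with \<epsilon> m_int m_le show ?thesis by blast
qed

section \<open>The squared distance in a chart\<close>

text \<open>
  The function \<open>g\<close> need not be measurable, so its integral against the image measure cannot simply
  be transformed.  It dominates \<open>c\<close>, and \<open>c\<close> is measurable on \<open>W\<close> because there it is the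
  measurable function \<open>\<lambda>x. c (\<theta> x)\<close> composed with the inverse \<open>\<psi>\<close> of \<open>\<theta>\<close>.
\<close>

lemma nn_integral_le_nn_integral_distr:
  fixes g c :: "'b::topological_space \<Rightarrow> ennreal"
  assumes \<theta> [measurable]: "\<theta> \<in> measurable Q borel" and \<psi> [measurable]: "\<psi> \<in> measurable borel Q"
    and c [measurable]: "(\<lambda>x. c (\<theta> x)) \<in> borel_measurable Q"
    and W [measurable]: "W \<in> sets borel" and inv: "\<And>y. y \<in> W \<Longrightarrow> \<theta> (\<psi> y) = y" and into: "\<And>x. \<theta> x \<in> W"
    and le: "\<And>y. c y \<le> g y"
  shows "(\<integral>\<^sup>+ x. c (\<theta> x) \<partial>Q) \<le> (\<integral>\<^sup>+ y. g y \<partial>distr Q borel \<theta>)"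
proof -
  let ?c = "\<lambda>y. c (\<theta> (\<psi> y)) * indicator W y"
  have "(\<integral>\<^sup>+ x. c (\<theta> x) \<partial>Q) = (\<integral>\<^sup>+ x. ?c (\<theta> x) \<partial>Q)"
    by (simp add: inv into)
  also have "\<dots> = (\<integral>\<^sup>+ y. ?c y \<partial>distr Q borel \<theta>)"
    by (intro nn_integral_distr[symmetric]) measurable
  also have "\<dots> \<le> (\<integral>\<^sup>+ y. g y \<partial>distr Q borel \<theta>)"
    by (intro nn_integral_mono) (auto simp: inv le split: split_indicator)
  finally show ?thesis .
qed

lemma integrable_square_dist:
  fixes Q :: "'m::{metric_space, second_countable_topology} measure"
  assumes Q: "prob_space Q" and sets_Q [measurable_cong]: "sets Q = sets borel"
    and int: "integrable Q (\<lambda>x. (dist x q)\<^sup>2)"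
  shows "integrable Q (\<lambda>x. (dist x p)\<^sup>2)"
proof -
  interpret prob_space Q by fact
  show ?thesis
  proof (rule Bochner_Integration.integrable_bound)
    show "integrable Q (\<lambda>x. 2 * (dist x q)\<^sup>2 + 2 * (dist q p)\<^sup>2)"
      using int by simp
    show "AE x in Q. norm ((dist x p)\<^sup>2) \<le> norm (2 * (dist x q)\<^sup>2 + 2 * (dist q p)\<^sup>2)"
      using dist_square_le_weighted[of 1 _ p q] by (auto simp: add.commute)
  qed measurable
qed

lemma frechet_fun_eq_integral:
  assumes "integrable Q (\<lambda>x. (dist x p)\<^sup>2)"
  shows "frechet_fun Q p = ennreal (\<integral>x. (dist x p)\<^sup>2 \<partial>Q)"
  unfolding frechet_fun_def using nn_integral_eq_integral[OF assms] by (simp add: dist_commute)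

lemma frechet_variation_eq:
  assumes "p \<in> frechet_mean_set Q"
  shows "frechet_variation Q = enn2real (frechet_fun Q p)"
proof -
  have "(INF q. frechet_fun Q q) = frechet_fun Q p"
    using assms by (intro INF_eqI) (auto simp: frechet_mean_set_def)
  then show ?thesis by (simp add: frechet_variation_def)
qed

text \<open>
  The law of the coordinates as an image of \<open>Q\<close> itself, under a measurable map \<open>\<theta>\<close> that extends the
  chart to the whole manifold.
\<close>

lemma coord_law_eq_distr:
  assumes sets_Q [measurable_cong]: "sets Q = sets borel" and AE: "AE x in Q. x \<in> U"
    and U [measurable]: "U \<in> sets borel"
    and \<theta> [measurable]: "\<theta> \<in> measurable Q borel" and eq: "\<And>x. x \<in> U \<Longrightarrow> \<theta> x = \<phi> x"
  shows "coord_law Q U \<phi> = distr Q borel \<theta>"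
proof (rule measure_eqI)
  show "sets (coord_law Q U \<phi>) = sets (distr Q borel \<theta>)" by (simp add: coord_law_def)
  fix A assume "A \<in> sets (coord_law Q U \<phi>)"
  then have A [measurable]: "A \<in> sets borel" by (simp add: coord_law_def)
  have space: "space Q = UNIV" using sets_Q by (metis sets_eq_imp_space_eq space_borel)
  have sp: "space (restrict_space Q U) = U" by (simp add: space_restrict_space space)
  have meas: "\<phi> \<in> measurable (restrict_space Q U) borel"
    using measurable_restrict_space1[OF \<theta>, of U]
    by (subst measurable_cong[where g=\<theta>]) (auto simp: sp eq)
  have UQ: "U \<inter> space Q \<in> sets Q" using U by (simp add: sets_Q space)
  have "emeasure (coord_law Q U \<phi>) A = emeasure (restrict_space Q U) (\<phi> -` A \<inter> U)"
    unfolding coord_law_def by (subst emeasure_distr[OF meas A]) (simp add: sp)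
  also have "\<dots> = emeasure Q (\<phi> -` A \<inter> U)"
    by (rule emeasure_restrict_space[OF UQ]) auto
  also have "\<phi> -` A \<inter> U = \<theta> -` A \<inter> U" by (auto simp: eq)
  also have "emeasure Q (\<theta> -` A \<inter> U) = emeasure Q (\<theta> -` A \<inter> space Q)"
  proof (rule emeasure_eq_AE)
    show "AE x in Q. (x \<in> \<theta> -` A \<inter> U) = (x \<in> \<theta> -` A \<inter> space Q)"
      using AE by (rule eventually_mono) (simp add: space)
    show "\<theta> -` A \<inter> space Q \<in> sets Q" by measurable
    then show "\<theta> -` A \<inter> U \<in> sets Q"
      using U by (simp add: sets_Q space sets.Int)
  qed
  also have "\<dots> = emeasure (distr Q borel \<theta>) A"
    by (simp add: emeasure_distr)
  finally show "emeasure (coord_law Q U \<phi>) A = emeasure (distr Q borel \<theta>) A" .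
qed

text \<open>
  Here the general result on minima of sample means is applied to
  \<open>w \<mapsto> \<rho>\<^sup>2(x, \<phi>\<^sup>-\<^sup>1(\<phi> a + w))\<close>.  Points outside the patch are first moved to \<open>a\<close> by \<open>\<kappa>\<close>.  This
  changes nothing almost surely, and it makes \<open>\<theta> = \<phi> \<circ> \<kappa>\<close> a measurable map into \<open>\<phi> ` U\<close>, so that
  the smoothness hypotheses hold for every \<open>x\<close>.
\<close>

lemma sample_frechet_excess_near_mean:
  fixes X :: "nat \<Rightarrow> 'w \<Rightarrow> 'm::{metric_space, second_countable_topology}"
    and Q :: "'m measure" and U :: "'m set" and \<phi> :: "'m \<Rightarrow> real^'d"
  defines "h \<equiv> chart_sqdist U \<phi>" and "QY \<equiv> coord_law Q U \<phi>"
  assumes iid: "iid_sample P X Q"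
    and chart: "topological_chart U \<phi>" and AE_U: "AE x in Q. x \<in> U" and a: "a \<in> U"
    and int: "integrable Q (\<lambda>x. (dist x a)\<^sup>2)"
    and min: "\<And>p. (\<integral>x. (dist x a)\<^sup>2 \<partial>Q) \<le> (\<integral>x. (dist x p)\<^sup>2 \<partial>Q)"
    and N: "open N" "\<phi> a \<in> N"
    and C2: "\<And>x. x \<in> \<phi> ` U \<Longrightarrow> Ck_on 2 (h x) N"
    and D2: "\<And>r. integrable QY (\<lambda>x. (partial_deriv r (h x) (\<phi> a))\<^sup>2)"
    and osc: "\<And>r s. ((\<lambda>\<epsilon>. \<integral>\<^sup>+ x. (SUP (u, v) \<in> {(u, v). u \<in> N \<and> v \<in> N \<and> norm (u - v) \<le> \<epsilon>}.
        ennreal \<bar>partial_deriv s (partial_deriv r (h x)) v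
               - partial_deriv s (partial_deriv r (h x)) u\<bar>) \<partial>QY) \<longlongrightarrow> 0) (at_right 0)"
    and H: "\<And>r s. integrable QY (\<lambda>x. partial_deriv s (partial_deriv r (h x)) (\<phi> a))"
    and inv: "invertible (\<chi> r s. \<integral>x. partial_deriv s (partial_deriv r (h x)) (\<phi> a) \<partial>QY)"
  obtains \<epsilon> where "\<epsilon> > 0" "\<And>e. e > 0 \<Longrightarrow> prob_space.whp P (\<lambda>n \<omega>. \<forall>p\<in>U. norm (\<phi> p - \<phi> a) < \<epsilon> \<longrightarrow>
      sqrt (real n) * (sample_frechet_fun (\<lambda>j. X j \<omega>) n a - sample_frechet_fun (\<lambda>j. X j \<omega>) n p) < e)"
proof -
  interpret iid_sample P X Q by fact
  let ?\<psi> = "inv_into U \<phi>"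
  have U: "open U" "open (\<phi> ` U)" "inj_on \<phi> U" and cont: "continuous_on U \<phi>" "continuous_on (\<phi> ` U) ?\<psi>"
    using chart by (auto simp: topological_chart_def homeomorphism_def)
  have [measurable]: "U \<in> sets borel" "\<phi> ` U \<in> sets borel" using U by auto
  define \<kappa> where "\<kappa> x = (if x \<in> U then x else a)" for x
  define \<theta> where "\<theta> x = \<phi> (\<kappa> x)" for x
  define \<psi> where "\<psi> y = (if y \<in> \<phi> ` U then ?\<psi> y else a)" for y
  have \<kappa>U: "\<kappa> x \<in> U" for x using a by (simp add: \<kappa>_def)
  have \<theta>U: "\<theta> x \<in> \<phi> ` U" for x using \<kappa>U by (simp add: \<theta>_def)
  have \<psi>\<theta>: "?\<psi> (\<theta> x) = \<kappa> x" for x using U(3) \<kappa>U by (simp add: \<theta>_def)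
  have [measurable]: "\<kappa> \<in> measurable borel borel"
    unfolding \<kappa>_def by measurable
  have "\<theta> = (\<lambda>x. if x \<in> U then \<phi> x else \<phi> a)" by (auto simp: \<theta>_def \<kappa>_def)
  then have [measurable]: "\<theta> \<in> measurable borel borel"
    using borel_measurable_continuous_on_if[of U \<phi> "\<lambda>_. \<phi> a"] cont by simp
  have [measurable]: "\<psi> \<in> measurable borel borel"
    unfolding \<psi>_def using borel_measurable_continuous_on_if[of "\<phi> ` U" ?\<psi> "\<lambda>_. a"] cont by simp
  have QY: "QY = distr Q borel \<theta>"
    unfolding QY_def by (rule coord_law_eq_distr[OF sets_Q AE_U]) (auto simp: \<theta>_def \<kappa>_def)

  define k where "k x = h (\<theta> x)" for x
  have k_eq: "k x v = (dist (\<kappa> x) (?\<psi> v))\<^sup>2" for x v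
    by (simp add: k_def h_def chart_sqdist_def \<psi>\<theta>)
  have k_U: "k x v = (dist x (?\<psi> v))\<^sup>2" if "x \<in> U" for x v
    using that by (simp add: k_eq \<kappa>_def)
  have k_meas [measurable]: "(\<lambda>x. k x v) \<in> borel_measurable borel" for v
    unfolding k_eq by measurable
  have C2k: "Ck_on 2 (k x) N" for x using C2[OF \<theta>U] by (simp add: k_def)
  let ?G = "\<lambda>x. gradient (k x) (\<phi> a)"
  let ?H = "\<lambda>x. hessian (k x) (\<phi> a)"
  let ?f = "\<lambda>x w. k x (\<phi> a + w)"
  have k_int: "integrable Q (\<lambda>x. k x v)" and k_integral: "(\<integral>x. k x v \<partial>Q) = (\<integral>x. (dist x (?\<psi> v))\<^sup>2 \<partial>Q)" for v
  proof -
    have ae: "AE x in Q. (dist x (?\<psi> v))\<^sup>2 = k x v"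
      using AE_U by (rule eventually_mono) (simp add: k_U)
    have i: "integrable Q (\<lambda>x. (dist x (?\<psi> v))\<^sup>2)"
      by (rule integrable_square_dist[OF prob_space_Q sets_Q int])
    show "integrable Q (\<lambda>x. k x v)"
      by (rule integrable_cong_AE[THEN iffD1, OF _ _ ae i]) measurable
    show "(\<integral>x. k x v \<partial>Q) = (\<integral>x. (dist x (?\<psi> v))\<^sup>2 \<partial>Q)"
      by (rule integral_cong_AE) (use ae in auto)
  qed
  have D1_meas: "(\<lambda>x. partial_deriv r (k x) v) \<in> borel_measurable borel" if "v \<in> N" for r v
    by (rule borel_measurable_partial_deriv[OF k_meas N(1) that])
       (rule Ck_on_2_differentiable[OF C2k N(1) that])
  have D2_meas: "(\<lambda>x. partial_deriv s (partial_deriv r (k x)) v) \<in> borel_measurable borel" if "v \<in> N" for r s v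
    by (rule borel_measurable_partial_deriv[OF D1_meas N(1) that])
       (auto intro: Ck_on_2_partial_deriv_differentiable[OF C2k N(1) that])
  obtain D :: "(real^'d) set" where D: "countable D" "\<And>S. open S \<Longrightarrow> S \<noteq> {} \<Longrightarrow> \<exists>d\<in>D. d \<in> S"
    by (rule countable_dense_setE) blast
  have osc_k: "((\<lambda>\<epsilon>. \<integral>\<^sup>+ x. (SUP v\<in>D \<inter> N \<inter> ball (\<phi> a) \<epsilon>.
        ennreal \<bar>partial_deriv s (partial_deriv r (k x)) v - partial_deriv s (partial_deriv r (k x)) (\<phi> a)\<bar>) \<partial>Q)
        \<longlongrightarrow> 0) (at_right 0)" for r s
  \<comment> \<open>Pairs \<open>(\<phi> a, v)\<close> with \<open>v\<close> in a countable dense set are among the pairs of the supremum in the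
    hypothesis.\<close>
  proof (rule tendsto_sandwich[OF _ _ tendsto_const osc[of s r]])
    let ?c = "\<lambda>\<epsilon> y. SUP v\<in>D \<inter> N \<inter> ball (\<phi> a) \<epsilon>.
        ennreal \<bar>partial_deriv s (partial_deriv r (h y)) v - partial_deriv s (partial_deriv r (h y)) (\<phi> a)\<bar>"
    have "(\<integral>\<^sup>+ x. ?c \<epsilon> (\<theta> x) \<partial>Q)
      \<le> (\<integral>\<^sup>+ x. (SUP (u, v) \<in> {(u, v). u \<in> N \<and> v \<in> N \<and> norm (u - v) \<le> \<epsilon>}.
        ennreal \<bar>partial_deriv s (partial_deriv r (h x)) v
               - partial_deriv s (partial_deriv r (h x)) u\<bar>) \<partial>distr Q borel \<theta>)" for \<epsilon>
    proof (rule nn_integral_le_nn_integral_distr[where \<psi>=\<psi> and W="\<phi> ` U"])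
      have "(\<lambda>x. ?c \<epsilon> (\<theta> x)) \<in> borel_measurable borel"
        unfolding k_def[symmetric]
        by (intro borel_measurable_SUP measurable_compose[OF _ measurable_ennreal] borel_measurable_abs
              borel_measurable_diff D2_meas N countable_Int1 D) auto
      then show "(\<lambda>x. ?c \<epsilon> (\<theta> x)) \<in> borel_measurable Q"
        using measurable_cong_sets[OF sets_Q refl] by blast
      show "\<theta> (\<psi> y) = y" if "y \<in> \<phi> ` U" for y
        using that by (auto simp: \<theta>_def \<psi>_def \<kappa>_def f_inv_into_f inv_into_into)
      show "?c \<epsilon> y \<le> (SUP (u, v) \<in> {(u, v). u \<in> N \<and> v \<in> N \<and> norm (u - v) \<le> \<epsilon>}.
        ennreal \<bar>partial_deriv s (partial_deriv r (h y)) v - partial_deriv s (partial_deriv r (h y)) u\<bar>)" for y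
      proof (rule SUP_least)
        fix v assume "v \<in> D \<inter> N \<inter> ball (\<phi> a) \<epsilon>"
        then have "(\<phi> a, v) \<in> {(u, v). u \<in> N \<and> v \<in> N \<and> norm (u - v) \<le> \<epsilon>}"
          using N by (auto simp: dist_norm)
        then show "ennreal \<bar>partial_deriv s (partial_deriv r (h y)) v - partial_deriv s (partial_deriv r (h y)) (\<phi> a)\<bar>
          \<le> (SUP (u, v) \<in> {(u, v). u \<in> N \<and> v \<in> N \<and> norm (u - v) \<le> \<epsilon>}.
            ennreal \<bar>partial_deriv s (partial_deriv r (h y)) v - partial_deriv s (partial_deriv r (h y)) u\<bar>)"
          by (rule SUP_upper2) simp
      qed
    qed (use \<theta>U in measurable)
    then show "\<forall>\<^sub>F \<epsilon> in at_right 0. (\<integral>\<^sup>+ x. (SUP v\<in>D \<inter> N \<inter> ball (\<phi> a) \<epsilon>.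
        ennreal \<bar>partial_deriv s (partial_deriv r (k x)) v - partial_deriv s (partial_deriv r (k x)) (\<phi> a)\<bar>) \<partial>Q)
      \<le> (\<integral>\<^sup>+ x. (SUP (u, v) \<in> {(u, v). u \<in> N \<and> v \<in> N \<and> norm (u - v) \<le> \<epsilon>}.
        ennreal \<bar>partial_deriv s (partial_deriv r (h x)) v
               - partial_deriv s (partial_deriv r (h x)) u\<bar>) \<partial>QY)"
      unfolding QY k_def by simp
  qed simp
  have k_measQ: "(\<lambda>x. k x v) \<in> borel_measurable Q" for v by measurable
  have HQ: "integrable Q (\<lambda>x. ?H x $ r $ s)" and HE: "(\<integral>x. ?H x $ r $ s \<partial>Q) =
      (\<integral>x. partial_deriv s (partial_deriv r (h x)) (\<phi> a) \<partial>QY)" for r s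
  proof -
    have m: "(\<lambda>x. partial_deriv s (partial_deriv r (h x)) (\<phi> a)) \<in> borel_measurable borel"
      using borel_measurable_integrable[OF H[of s r]] by (simp add: QY)
    show "integrable Q (\<lambda>x. ?H x $ r $ s)"
      using H[of s r] integrable_distr_eq[OF _ m, of \<theta> Q] by (simp add: QY hessian_def k_def)
    show "(\<integral>x. ?H x $ r $ s \<partial>Q) = (\<integral>x. partial_deriv s (partial_deriv r (h x)) (\<phi> a) \<partial>QY)"
      using integral_distr[OF _ m, of \<theta> Q] by (simp add: QY hessian_def k_def)
  qed
  obtain \<epsilon> where \<epsilon>: "\<epsilon> > 0" and excess: "\<And>e. e > 0 \<Longrightarrow> whp (\<lambda>n \<omega>. \<forall>w. norm w < \<epsilon> \<longrightarrow>
      sqrt (real n) * (sample_mean (\<lambda>j. X j \<omega>) (\<lambda>x. ?f x 0) n - sample_mean (\<lambda>j. X j \<omega>) (\<lambda>x. ?f x w) n) < e)"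
  proof (rule sample_minimum_excess_whp[where f="?f" and G="?G" and H="?H" and R=1])
    show "(\<lambda>x. ?G x $ r) \<in> borel_measurable borel" for r
      using D1_meas[OF N(2)] by (simp add: gradient_def)
    show "integrable Q (\<lambda>x. (?G x $ r)\<^sup>2)" for r
      using D2[of r] integrable_distr[of \<theta> Q borel "\<lambda>x. (partial_deriv r (h x) (\<phi> a))\<^sup>2"]
      by (simp add: QY gradient_def k_def)
    show "integrable Q (\<lambda>x. ?H x $ r $ s)" for r s by (rule HQ)
    show "(\<integral>x. ?f x 0 \<partial>Q) \<le> (\<integral>x. ?f x w \<partial>Q)" for w
      using min U(3) a by (simp add: k_integral)
    show "\<exists>\<epsilon>>0. \<exists>m. integrable Q m \<and> (\<integral>x. m x \<partial>Q) \<le> \<eta> \<and>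
      (AE x in Q. \<forall>w. norm w < \<epsilon> \<longrightarrow>
         \<bar>?f x w - ?f x 0 - (?G x \<bullet> w + w \<bullet> (?H x *v w) / 2)\<bar> \<le> m x * (norm w)\<^sup>2)" if "\<eta> > 0" for \<eta>
      by (rule Taylor_expansion_in_mean[OF C2k N k_measQ D osc_k that])
    show "transpose (\<chi> r s. \<integral>x. ?H x $ r $ s \<partial>Q) = (\<chi> r s. \<integral>x. ?H x $ r $ s \<partial>Q)"
      by (simp add: transpose_def hessian_def vec_eq_iff partial_deriv_commute[OF C2k N])
    show "invertible (\<chi> r s. \<integral>x. ?H x $ r $ s \<partial>Q)" using inv by (simp add: HE)
  qed (use k_int in auto)
  show thesis
  proof (rule that[OF \<epsilon>])
    fix e :: real assume "e > 0"
    have "whp (\<lambda>n \<omega>. \<forall>j. X j \<omega> \<in> U)" by (intro whp_AE AE_X AE_U)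
    from whp_conj[OF this excess[OF \<open>e > 0\<close>]]
    show "whp (\<lambda>n \<omega>. \<forall>p\<in>U. norm (\<phi> p - \<phi> a) < \<epsilon> \<longrightarrow>
      sqrt (real n) * (sample_frechet_fun (\<lambda>j. X j \<omega>) n a - sample_frechet_fun (\<lambda>j. X j \<omega>) n p) < e)"
    proof (rule whp_mono, intro ballI impI, elim conjE)
      fix n \<omega> p
      assume XU: "\<forall>j. X j \<omega> \<in> U" and p: "p \<in> U" "norm (\<phi> p - \<phi> a) < \<epsilon>"
        and *: "\<forall>w. norm w < \<epsilon> \<longrightarrow> sqrt (real n) *
          (sample_mean (\<lambda>j. X j \<omega>) (\<lambda>x. ?f x 0) n - sample_mean (\<lambda>j. X j \<omega>) (\<lambda>x. ?f x w) n) < e"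
      have "sample_mean (\<lambda>j. X j \<omega>) (\<lambda>x. k x (\<phi> q)) n = sample_frechet_fun (\<lambda>j. X j \<omega>) n q" if "q \<in> U" for q
        using XU that U(3) by (simp add: sample_mean_def sample_frechet_fun_def k_U)
      with *[rule_format, OF p(2)] p(1) a
      show "sqrt (real n) * (sample_frechet_fun (\<lambda>j. X j \<omega>) n a - sample_frechet_fun (\<lambda>j. X j \<omega>) n p) < e"
        by simp
    qed
  qed
qed

section \<open>The limit law of the sample Frechet variation\<close>

theorem theorem2p5:
  fixes A :: "('m::{metric_space, second_countable_topology} set \<times> ('m \<Rightarrow> real^'d)) set"
    and Q :: "'m measure"
    and P :: "'w measure" and X :: "nat \<Rightarrow> 'w \<Rightarrow> 'm"
    and U :: "'m set" and \<phi> :: "'m \<Rightarrow> real^'d"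
    and \<mu>\<^sub>F :: 'm and \<mu> :: "real^'d" and N :: "(real^'d) set"
    and h :: "real^'d \<Rightarrow> real^'d \<Rightarrow> real" and QY :: "(real^'d) measure"
    and \<Lambda> \<Sigma> :: "real^'d^'d"
  defines "\<mu> \<equiv> \<phi> \<mu>\<^sub>F"
    and "h \<equiv> chart_sqdist U \<phi>"
    and "QY \<equiv> coord_law Q U \<phi>"
    and "\<Lambda> \<equiv> (\<chi> r s. \<integral> x. partial_deriv s (partial_deriv r (h x)) \<mu> \<partial>QY)"
    and "\<Sigma> \<equiv> cov_matrix QY (\<lambda>x. gradient (h x) \<mu>)"
  assumes manifold: "smooth_atlas A"
    and Q: "prob_space Q" "sets Q = sets borel"
    and P: "prob_space P"
    and indep: "prob_space.indep_vars P (\<lambda>_. borel) X UNIV"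
    and law: "\<And>j. distr P borel (X j) = Q"
    and i: "coordinate_patch A U \<phi>" "AE x in Q. x \<in> U"
    and ii: "frechet_mean_set Q = {\<mu>\<^sub>F}"
    and well_separated: "well_separated_mean Q \<mu>\<^sub>F"
    and iii: "\<mu>\<^sub>F \<in> U" "open N" "\<mu> \<in> N" "N \<subseteq> \<phi> ` U"
      "\<And>x. x \<in> \<phi> ` U \<Longrightarrow> Ck_on 2 (h x) N"
    and iv: "\<And>r. integrable QY (\<lambda>x. (partial_deriv r (h x) \<mu>)\<^sup>2)"
    and v: "\<And>r s. ((\<lambda>\<epsilon>. \<integral>\<^sup>+ x. (SUP (u, v) \<in> {(u, v). u \<in> N \<and> v \<in> N \<and> norm (u - v) \<le> \<epsilon>}.
        ennreal \<bar>partial_deriv s (partial_deriv r (h x)) v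
               - partial_deriv s (partial_deriv r (h x)) u\<bar>) \<partial>QY) \<longlongrightarrow> 0) (at_right 0)"
    and vi: "\<And>r s. integrable QY (\<lambda>x. partial_deriv s (partial_deriv r (h x)) \<mu>)"
      "invertible \<Lambda>"
    and vii: "invertible \<Sigma>"
    and moment4: "integrable P (\<lambda>\<omega>. dist (X 0 \<omega>) \<mu>\<^sub>F ^ 4)"
  shows "weak_conv_m
      (\<lambda>n. distr P borel
        (\<lambda>\<omega>. sqrt (real n) *
          (sample_frechet_variation (\<lambda>j. X j \<omega>) n - frechet_variation Q)))
      (normal_law 0 (prob_space.variance P (\<lambda>\<omega>. (dist (X 0 \<omega>) \<mu>\<^sub>F)\<^sup>2)))"
proof -
  interpret iid_sample P X Q
    using P indep law by (simp add: iid_sample_def iid_sample_axioms_def)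
  interpret Q: prob_space Q by (rule Q(1))
  have [measurable_cong]: "sets Q = sets borel" by (rule Q(2))
  have chart: "topological_chart U \<phi>" using i(1) by (simp add: coordinate_patch_def)
  have int4: "integrable Q (\<lambda>x. ((dist x \<mu>\<^sub>F)\<^sup>2)\<^sup>2)"
    using moment4 unfolding law[of 0, symmetric]
    by (subst integrable_distr_eq) (simp_all flip: power_mult)
  have "integrable Q (\<lambda>x. (dist x \<mu>\<^sub>F)\<^sup>2)"
    by (rule Q.square_integrable_imp_integrable[OF _ int4]) measurable
  then have int2: "integrable Q (\<lambda>x. (dist x p)\<^sup>2)" for p
    by (rule integrable_square_dist[OF Q])
  note F_eq = frechet_fun_eq_integral[OF int2]
  let ?F = "\<lambda>p. \<integral>x. (dist x p)\<^sup>2 \<partial>Q"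
  let ?Fn = "\<lambda>n \<omega>. sample_frechet_fun (\<lambda>j. X j \<omega>) n"
  let ?Vn = "\<lambda>n \<omega>. sample_frechet_variation (\<lambda>j. X j \<omega>) n"
  have F_nonneg: "0 \<le> ?F p" for p by simp
  have V: "frechet_variation Q = ?F \<mu>\<^sub>F"
    using frechet_variation_eq[of \<mu>\<^sub>F Q] ii by (simp add: F_eq F_nonneg)
  have min: "?F \<mu>\<^sub>F \<le> ?F p" for p
  proof -
    have "\<mu>\<^sub>F \<in> frechet_mean_set Q" using ii by simp
    then have "frechet_fun Q \<mu>\<^sub>F \<le> frechet_fun Q p" by (simp add: frechet_mean_set_def)
    then show ?thesis by (simp add: F_eq)
  qed
  obtain \<epsilon> where \<epsilon>: "\<epsilon> > 0" and near: "\<And>e. e > 0 \<Longrightarrow> whp (\<lambda>n \<omega>. \<forall>p\<in>U. norm (\<phi> p - \<mu>) < \<epsilon> \<longrightarrow>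
      sqrt (real n) * (?Fn n \<omega> \<mu>\<^sub>F - ?Fn n \<omega> p) < e)"
    using sample_frechet_excess_near_mean[OF iid_sample_axioms chart i(2) iii(1) int2 min iii(2)
        iii(3)[unfolded \<mu>_def] iii(5)[unfolded h_def] iv[unfolded QY_def h_def \<mu>_def] v[unfolded QY_def h_def]
        vi(1)[unfolded QY_def h_def \<mu>_def] vi(2)[unfolded \<Lambda>_def QY_def h_def \<mu>_def]]
    unfolding \<mu>_def by blast
  obtain r where r: "r > 0" and r_near: "\<And>p. dist p \<mu>\<^sub>F < r \<Longrightarrow> p \<in> U \<and> norm (\<phi> p - \<mu>) < \<epsilon>"
  proof -
    have "open U" "continuous_on U \<phi>" using chart by (auto simp: topological_chart_def homeomorphism_def)
    then have "open (U \<inter> \<phi> -` ball \<mu> \<epsilon>)" by (intro continuous_open_preimage) auto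
    moreover have "\<mu>\<^sub>F \<in> U \<inter> \<phi> -` ball \<mu> \<epsilon>" using iii(1) \<epsilon> by (simp add: \<mu>_def)
    ultimately obtain r where "r > 0" "ball \<mu>\<^sub>F r \<subseteq> U \<inter> \<phi> -` ball \<mu> \<epsilon>"
      by (meson open_contains_ball)
    then show thesis
      by (intro that[of r]) (auto simp: subset_eq dist_commute dist_norm norm_minus_commute)
  qed
  obtain \<delta> where \<delta>: "\<delta> > 0" and sep: "\<And>p. dist p \<mu>\<^sub>F \<ge> r \<Longrightarrow> frechet_fun Q p \<ge> frechet_fun Q \<mu>\<^sub>F + ennreal \<delta>"
    using well_separated r unfolding well_separated_mean_def by blast
  have sep': "(?F \<mu>\<^sub>F + \<delta> / 2) + \<delta> / 2 \<le> ?F p" if "p \<in> {p. r \<le> dist p \<mu>\<^sub>F}" for p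
  proof -
    have "ennreal (?F \<mu>\<^sub>F + \<delta>) \<le> ennreal (?F p)"
      using sep[of p] that \<delta> F_nonneg[of \<mu>\<^sub>F] by (simp add: F_eq ennreal_plus)
    then show ?thesis using F_nonneg[of p] by (simp add: ennreal_le_iff)
  qed
  have far: "whp (\<lambda>n \<omega>. \<forall>p\<in>{p. r \<le> dist p \<mu>\<^sub>F}. ?F \<mu>\<^sub>F + \<delta> / 2 < ?Fn n \<omega> p)"
    unfolding sample_frechet_fun_eq_sample_mean
    by (rule sample_frechet_lower_bound_whp[OF iid_sample_axioms int2 _ sep']) (use \<delta> in simp)
  have at: "whp (\<lambda>n \<omega>. \<bar>?Fn n \<omega> \<mu>\<^sub>F - ?F \<mu>\<^sub>F\<bar> < \<delta> / 2)"
    unfolding sample_frechet_fun_eq_sample_mean by (rule weak_law[OF int2]) (use \<delta> in simp)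
  have Fn_meas: "(\<lambda>\<omega>. ?Fn n \<omega> \<mu>\<^sub>F) \<in> borel_measurable P" for n
    unfolding sample_frechet_fun_def by measurable
  have Vn_meas: "(\<lambda>\<omega>. ?Vn n \<omega>) \<in> borel_measurable P" for n
    by (rule sample_frechet_variation_measurable) simp
  show ?thesis
  proof (rule Slutsky[where Y="\<lambda>n \<omega>. sqrt (real n) * (?Fn n \<omega> \<mu>\<^sub>F - ?F \<mu>\<^sub>F)"])
    show "weak_conv_m (\<lambda>n. distr P borel (\<lambda>\<omega>. sqrt (real n) * (?Fn n \<omega> \<mu>\<^sub>F - ?F \<mu>\<^sub>F)))
      (normal_law 0 (variance (\<lambda>\<omega>. (dist (X 0 \<omega>) \<mu>\<^sub>F)\<^sup>2)))"
      unfolding sample_frechet_fun_eq_sample_mean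
      by (rule central_limit_sample_mean[OF _ int4]) measurable
    show "real_distribution (normal_law 0 (variance (\<lambda>\<omega>. (dist (X 0 \<omega>) \<mu>\<^sub>F)\<^sup>2)))"
      by (rule real_distribution_normal_law)
    fix e :: real assume e: "e > 0"
    have "whp (\<lambda>n \<omega>. (\<forall>p\<in>U. norm (\<phi> p - \<mu>) < \<epsilon> \<longrightarrow> sqrt (real n) * (?Fn n \<omega> \<mu>\<^sub>F - ?Fn n \<omega> p) < e / 2)
       \<and> (\<forall>p\<in>{p. r \<le> dist p \<mu>\<^sub>F}. ?F \<mu>\<^sub>F + \<delta> / 2 < ?Fn n \<omega> p) \<and> \<bar>?Fn n \<omega> \<mu>\<^sub>F - ?F \<mu>\<^sub>F\<bar> < \<delta> / 2)"
      using e by (intro whp_conj[OF near whp_conj[OF far at]]) simp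
    then show "whp (\<lambda>n \<omega>. \<bar>sqrt (real n) * (?Vn n \<omega> - frechet_variation Q)
        - sqrt (real n) * (?Fn n \<omega> \<mu>\<^sub>F - ?F \<mu>\<^sub>F)\<bar> < e)"
    proof (rule whp_mono, elim conjE)
      fix n \<omega>
      assume near: "\<forall>p\<in>U. norm (\<phi> p - \<mu>) < \<epsilon> \<longrightarrow> sqrt (real n) * (?Fn n \<omega> \<mu>\<^sub>F - ?Fn n \<omega> p) < e / 2"
        and far: "\<forall>p\<in>{p. r \<le> dist p \<mu>\<^sub>F}. ?F \<mu>\<^sub>F + \<delta> / 2 < ?Fn n \<omega> p"
        and at: "\<bar>?Fn n \<omega> \<mu>\<^sub>F - ?F \<mu>\<^sub>F\<bar> < \<delta> / 2"
      \<comment> \<open>Points in the ball of radius \<open>r\<close> lie in the patch and close to \<open>\<mu>\<close> in coordinates; all others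
        cannot compete with \<open>\<mu>\<^sub>F\<close>.\<close>
      have le: "sqrt (real n) * (?Fn n \<omega> \<mu>\<^sub>F - ?Fn n \<omega> p) \<le> e / 2" for p
      proof (cases "dist p \<mu>\<^sub>F < r")
        case True
        then show ?thesis using near r_near[OF True] by (auto intro: less_imp_le)
      next
        case False
        then have "?F \<mu>\<^sub>F + \<delta> / 2 < ?Fn n \<omega> p" using far by auto
        then have "?Fn n \<omega> \<mu>\<^sub>F - ?Fn n \<omega> p \<le> 0" using at by linarith
        then have "sqrt (real n) * (?Fn n \<omega> \<mu>\<^sub>F - ?Fn n \<omega> p) \<le> 0" by (simp add: mult_nonneg_nonpos)
        then show ?thesis using e by linarith
      qed
      have "sqrt (real n) * (?Fn n \<omega> \<mu>\<^sub>F - ?Vn n \<omega>) \<le> e / 2"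
      proof (cases "n = 0")
        case False
        then have n: "sqrt (real n) > 0" by simp
        have "?Fn n \<omega> \<mu>\<^sub>F - e / 2 / sqrt (real n) \<le> ?Vn n \<omega>"
        proof (rule sample_frechet_variation_ge)
          fix p
          show "?Fn n \<omega> \<mu>\<^sub>F - e / 2 / sqrt (real n) \<le> ?Fn n \<omega> p"
            using le[of p] n by (simp add: field_simps)
        qed
        then show ?thesis using n by (simp add: field_simps)
      qed (use e in simp)
      moreover have "0 \<le> sqrt (real n) * (?Fn n \<omega> \<mu>\<^sub>F - ?Vn n \<omega>)"
        using sample_frechet_variation_le[of "\<lambda>j. X j \<omega>" n \<mu>\<^sub>F] by simp
      moreover have "sqrt (real n) * (?Vn n \<omega> - frechet_variation Q)
          - sqrt (real n) * (?Fn n \<omega> \<mu>\<^sub>F - ?F \<mu>\<^sub>F) = - (sqrt (real n) * (?Fn n \<omega> \<mu>\<^sub>F - ?Vn n \<omega>))"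
        by (simp add: V algebra_simps)
      ultimately show "\<bar>sqrt (real n) * (?Vn n \<omega> - frechet_variation Q)
          - sqrt (real n) * (?Fn n \<omega> \<mu>\<^sub>F - ?F \<mu>\<^sub>F)\<bar> < e"
        using e by linarith
    qed
  qed (use Fn_meas Vn_meas in measurable)
qed

end
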